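(* Let $\mathbf X(t)$, $t>0$, be the three-dimensional symmetric Markov random flight with speed $c>0$ and switching intensity $\lambda>0$, and let $H_n(\boldsymbol\alpha,t)$ be its conditional characteristic function corresponding to $n$ changes of direction. For $\boldsymbol\alpha=(\alpha_1,\alpha_2,\alpha_3)\in\mathbb R^3$, $\Vert\boldsymbol\alpha\Vert=\sqrt{\alpha_1^2+\alpha_2^2+\alpha_3^2}$, and $t>0$, the conditional characteristic functions corresponding to two and three changes of direction are given, respectively, by $$H_2(\boldsymbol\alpha,t)=\sum_{k=0}^{\infty}\frac{(ct\Vert\boldsymbol\alpha\Vert)^{k-1}}{2^{k-1}\,k!\,(2k+1)^2}\;{}_5F_4\left(1,1,1,-k,-k-\tfrac12;\;-k+\tfrac12,-k+\tfrac12,\tfrac32,2;\;1\right)J_{k+1}(ct\Vert\boldsymbol\alpha\Vert),$$ $$H_3(\boldsymbol\alpha,t)=3\pi^{3/2}\sum_{k=0}^{\infty}\frac{\gamma_k\,(ct\Vert\boldsymbol\alpha\Vert)^{k-3/2}}{2^{k+3/2}\,(k+1)!}\;J_{k+3/2}(ct\Vert\boldsymbol\alpha\Vert),$$ where the coefficients $\gamma_k$ are given by $$\gamma_k=\frac{1}{k+2}\sum_{l=0}^{k}\frac{l!\,(k-l)!}{(l+1)\,\Gamma\left(l+\frac32\right)\Gamma\left(k-l+\frac32\right)},\qquad k\ge 0.$$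
   Context: The three-dimensional symmetric Markov random flight $\mathbf X(t)=(X_1(t),X_2(t),X_3(t))$: a particle starts at time $t=0$ from the origin of $\mathbb R^3$ and moves with constant speed $c>0$. Its initial direction is uniformly distributed on the unit sphere $S_1=\{\mathbf x\in\mathbb R^3:\Vert\mathbf x\Vert=1\}$. A homogeneous Poisson process $N(t)$ of rate $\lambda>0$ controls the motion: at each Poisson event the particle instantaneously takes a new random direction, uniformly distributed on $S_1$ and independent of its previous motion, and keeps moving with the same speed $c$ until the next Poisson event, and so on. $\mathbf X(t)$ is the particle's position at time $t$. The conditional characteristic function corresponding to $n$ changes of direction is $H_n(\boldsymbol\alpha,t)=\mathbb E\left[e^{i\langle\boldsymbol\alpha,\mathbf X(t)\rangle}\,\middle|\,N(t)=n\right]$, i.e. the Fourier transform in $\mathbf x$ of the conditional density $p_n(\mathbf x,t)$ of $\mathbf X(t)$ given that exactly $n$ Poisson events occurred in $(0,t)$. $J_\nu(z)$ is the Bessel function of the first kind, and $${}_5F_4(a_1,\dots,a_5;\,b_1,\dots,b_4;\,z)=\sum_{m=0}^{\infty}\frac{(a_1)_m(a_2)_m(a_3)_m(a_4)_m(a_5)_m}{(b_1)_m(b_2)_m(b_3)_m(b_4)_m}\,\frac{z^m}{m!}$$ is the generalized hypergeometric function, with $(x)_m=x(x+1)\cdots(x+m-1)$ the Pochhammer symbol. At $\boldsymbol\alpha=\mathbf 0$ the terms of the series are understood by continuity. *)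

theory Defs
  imports "HOL-Probability.Probability"
begin

section \<open>Special functions\<close>

text \<open>
  The Bessel function of the first kind, by its power series, on the positive real axis.
  (As \<open>0 powr a = 0\<close>, the value at \<open>z = 0\<close> is the right one only for \<open>\<nu> > 0\<close>.)
\<close>
definition bessel_J :: "real \<Rightarrow> real \<Rightarrow> real" where
  "bessel_J \<nu> z =
     (\<Sum>m. (-1) ^ m / (fact m * Gamma (real m + \<nu> + 1)) * (z / 2) powr (2 * real m + \<nu>))"

definition hypergeometric_F :: "real list \<Rightarrow> real list \<Rightarrow> real \<Rightarrow> real" where
  "hypergeometric_F as bs z = eval_fps (fps_hypergeo as bs 1) z"

lemma hypergeometric_F_altdef:
  "hypergeometric_F as bs z =
     (\<Sum>m. (\<Prod>a\<leftarrow>as. pochhammer a m) / (\<Prod>b\<leftarrow>bs. pochhammer b m) * z ^ m / fact m)"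
proof -
  have *: "foldl (\<lambda>r a. r * pochhammer a m) x xs = x * (\<Prod>a\<leftarrow>xs. pochhammer a m)"
    for m :: nat and x :: real and xs
    by (induction xs arbitrary: x) (simp_all add: mult.assoc)
  show ?thesis
    by (simp add: hypergeometric_F_def eval_fps_def fps_hypergeo_nth * mult_ac)
qed

text \<open>The value of \<open>f\<close> at \<open>z \<ge> 0\<close>, where \<open>z = 0\<close> is understood by continuity.\<close>
definition cont_at_0 :: "(real \<Rightarrow> real) \<Rightarrow> real \<Rightarrow> real" where
  "cont_at_0 f z = (if z = 0 then Lim (at_right 0) f else f z)"


section \<open>The three-dimensional symmetric Markov random flight\<close>

text \<open>
  The uniform distribution on the unit sphere, i.e. the normalised surface measure: the measure
  of a set of directions is the relative volume of the part of the unit ball lying in these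
  directions. (The null set \<open>{0}\<close> is mapped to \<open>0\<close>.)
\<close>
definition uniform_sphere :: "(real ^ 3) measure" where
  "uniform_sphere = distr (uniform_measure lborel (ball 0 1)) borel (\<lambda>x. x /\<^sub>R norm x)"

text \<open>
  \<open>T k\<close> is the waiting time between the \<open>k\<close>-th and the \<open>(k+1)\<close>-th event of the Poisson process
  of rate \<open>l\<close> (the \<open>0\<close>-th event being the start at time \<open>0\<close>), and \<open>D k\<close> is the direction of
  motion during that time. All these random variables are mutually independent; as \<open>indep_vars\<close>
  only applies to families with a common value type, this is stated for the generated events.
\<close>
locale markov_random_flight = prob_space M
  for M :: "'a measure" and c l :: real
    and T :: "nat \<Rightarrow> 'a \<Rightarrow> real" and D :: "nat \<Rightarrow> 'a \<Rightarrow> real ^ 3" +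
  assumes speed_pos: "c > 0"
    and rate_pos: "l > 0"
    and waiting_time_distributed: "distributed M lborel (T k) (exponential_density l)"
    and direction_measurable: "random_variable borel (D k)"
    and direction_distr: "distr M borel (D k) = uniform_sphere"
    and indep:
      "indep_sets (case_sum (\<lambda>k. {T k -` A \<inter> space M |A. A \<in> sets borel})
                            (\<lambda>k. {D k -` A \<inter> space M |A. A \<in> sets borel})) UNIV"

definition event_time :: "(nat \<Rightarrow> 'a \<Rightarrow> real) \<Rightarrow> nat \<Rightarrow> 'a \<Rightarrow> real" where
  "event_time T n \<omega> = (\<Sum>k<n. T k \<omega>)"

text \<open>The Poisson process \<open>N(t)\<close>. The set is infinite only on a null set.\<close>
definition event_count :: "(nat \<Rightarrow> 'a \<Rightarrow> real) \<Rightarrow> real \<Rightarrow> 'a \<Rightarrow> nat" where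
  "event_count T t \<omega> = card {n. n \<ge> 1 \<and> event_time T n \<omega> \<le> t}"

definition flight_position ::
  "real \<Rightarrow> (nat \<Rightarrow> 'a \<Rightarrow> real) \<Rightarrow> (nat \<Rightarrow> 'a \<Rightarrow> real ^ 3) \<Rightarrow> real \<Rightarrow> 'a \<Rightarrow> real ^ 3" where
  "flight_position c T D t \<omega> =
     (let n = event_count T t \<omega> in
        c *\<^sub>R ((\<Sum>k<n. T k \<omega> *\<^sub>R D k \<omega>) + (t - event_time T n \<omega>) *\<^sub>R D n \<omega>))"

definition cond_char_fun ::
  "'a measure \<Rightarrow> real \<Rightarrow> (nat \<Rightarrow> 'a \<Rightarrow> real) \<Rightarrow> (nat \<Rightarrow> 'a \<Rightarrow> real ^ 3) \<Rightarrow> nat \<Rightarrow>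
     real ^ 3 \<Rightarrow> real \<Rightarrow> complex" where
  "cond_char_fun M c T D n \<alpha> t =
     (LINT \<omega> | uniform_measure M {\<omega> \<in> space M. event_count T t \<omega> = n}.
        iexp (\<alpha> \<bullet> flight_position c T D t \<omega>))"

definition flight_gamma :: "nat \<Rightarrow> real" where
  "flight_gamma k = 1 / (real k + 2) *
     (\<Sum>j=0..k. fact j * fact (k - j) /
        ((real j + 1) * Gamma (real j + 3/2) * Gamma (real (k - j) + 3/2)))"

definition H2_term :: "nat \<Rightarrow> real \<Rightarrow> real" where
  "H2_term k z =
     z powr (real k - 1) / (2 powr (real k - 1) * fact k * (2 * real k + 1) ^ 2)
     * hypergeometric_F [1, 1, 1, - real k, - real k - 1/2]
         [- real k + 1/2, - real k + 1/2, 3/2, 2] 1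
     * bessel_J (real k + 1) z"

definition H3_term :: "nat \<Rightarrow> real \<Rightarrow> real" where
  "H3_term k z =
     flight_gamma k * z powr (real k - 3/2) / (2 powr (real k + 3/2) * fact (k + 1))
     * bessel_J (real k + 3/2) z"

end

(*
  Conditioning on the first switch shows that H_n is n! / t^n times an (n+1)-fold convolution power
  of sin(r s) / (r s), r = c ||alpha||, evaluated at t. Expanding into powers, where convolution is
  explicit, gives
    H_n = n! sum_N (-1)^N z^(2N) / (2N+n)! [x^(2N)] (artanh x / x)^(n+1),   z = c t ||alpha||.
  On the other side, inserting the Bessel series and collecting powers of z turns the claim into an
  identity between the coefficients of (artanh x / x)^(n+1) and an alternating binomial sum of
  coefficients of (arcsin s / s)^(n+1). Both are related by the substitution
  artanh x = arsinh (x / sqrt (1 - x^2)), and the hypergeometric values and the gamma_k are, up to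
  simple factors, the coefficients of (arcsin s / s)^3 and (arcsin s / s)^4.
*)
theory Submission
  imports Defs
begin

section \<open>The uniform distribution on the sphere\<close>

text \<open>Powers are used because the normalised monomials \<open>x^p / p!\<close> convolve to
  \<open>x^(p+q+1) / (p+q+1)!\<close>: up to the shift by one, convolution becomes multiplication of
  coefficient series. In this normalisation \<open>sin (r s) / (r s)\<close> has the coefficients
  \<open>(-1)^m r^(2m) / (2m+1)\<close>, since \<open>(2m+1)! = (2m+1) (2m)!\<close>; this is the
  origin of artanh. All series are even and are kept in the variable \<open>y = x^2\<close>, where
  the substitution reads \<open>y -> -y / (1 - y)\<close> and needs no imaginary unit. The factor
  \<open>(1 - y)^(-(n+1)/2)\<close> that comes with it produces the Pochhammer symbols
  \<open>(k + (n+1)/2)_(N-k)\<close>. By duplication \<open>(2N+n)!\<close> splits into an integer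
  and a half-integer Pochhammer symbol: one absorbs these symbols, the other is the Gamma value in
  the Bessel series. The parity of \<open>n\<close> decides which, hence integer Bessel orders for
  two changes and half-integer ones for three. On the probabilistic side, waiting times and
  directions have different value types, so independence is used through generated sigma-algebras
  instead of joint random vectors.\<close>

lemma summable_power_over_fact: "summable (\<lambda>m. x ^ m / fact m :: real)"
  using summable_exp[of x] by (simp add: divide_inverse mult.commute)

text \<open>An orthogonal map preserves Lebesgue measure and maps the unit ball onto itself, so the
  preimage of \<open>A\<close> in the ball and its image, the part of \<open>A\<close> in the ball,
  have equal volume.\<close>

lemma distr_uniform_ball_orthogonal:
  fixes f :: "real ^ 3 \<Rightarrow> real ^ 3"
  assumes f: "orthogonal_transformation f"
  shows "distr (uniform_measure lborel (ball 0 1)) borel f = uniform_measure lborel (ball 0 1)"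
proof (rule measure_eqI)
  have meas [measurable]: "f \<in> borel_measurable borel"
    using f by (intro borel_measurable_continuous_onI linear_continuous_on
        linear_conv_bounded_linear[THEN iffD1] orthogonal_transformation_linear)
  fix A assume "A \<in> sets (distr (uniform_measure lborel (ball 0 1)) borel f)"
  then have A [measurable]: "A \<in> sets borel" by simp
  define S where "S = ball 0 1 \<inter> f -` A"
  have fA [measurable]: "f -` A \<in> sets borel"
    using measurable_sets[OF meas A] by simp
  have S: "S \<in> sets borel" by (simp add: S_def)
  have image: "f ` S = ball 0 1 \<inter> A"
  proof -
    have "y \<in> f ` S" if "y \<in> ball 0 1" "y \<in> A" for y
    proof -
      obtain x where "y = f x"
        using orthogonal_transformation_surj[OF f] by (metis surjD)
      with that show ?thesis
        by (auto simp: S_def orthogonal_transformation_norm[OF f])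
    qed
    then show ?thesis
      by (auto simp: S_def orthogonal_transformation_norm[OF f])
  qed
  have fin: "X \<in> lmeasurable" "emeasure lborel X = ennreal (measure lebesgue X)"
    if "X \<in> sets borel" "X \<subseteq> ball 0 1" for X :: "(real ^ 3) set"
  proof -
    show X: "X \<in> lmeasurable"
      using that by (intro bounded_set_imp_lmeasurable) (auto intro: bounded_subset[OF bounded_ball])
    show "emeasure lborel X = ennreal (measure lebesgue X)"
      using that emeasure_eq_measure2[OF X] by simp
  qed
  have "emeasure lborel S = emeasure lborel (ball 0 1 \<inter> A)"
    using fin(2)[of S] fin(2)[of "ball 0 1 \<inter> A"] fin(1)[of S] measure_orthogonal_image[OF f, of S] S
    unfolding image by (simp add: S_def)
  then show "emeasure (distr (uniform_measure lborel (ball 0 1)) borel f) A =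
      emeasure (uniform_measure lborel (ball 0 1)) A"
    by (simp add: emeasure_distr S_def)
qed simp

lemma borel_measurable_normalize [measurable]:
  "(\<lambda>x :: real ^ 3. x /\<^sub>R norm x) \<in> borel_measurable borel"
  by measurable

text \<open>Normalisation commutes with orthogonal maps, so the invariance is inherited from the
  ball.\<close>

lemma distr_uniform_sphere_orthogonal:
  assumes f: "orthogonal_transformation f"
  shows "distr uniform_sphere borel f = uniform_sphere"
proof -
  have [measurable]: "f \<in> borel_measurable borel"
    using f by (intro borel_measurable_continuous_onI linear_continuous_on
        linear_conv_bounded_linear[THEN iffD1] orthogonal_transformation_linear)
  have "distr uniform_sphere borel f =
      distr (uniform_measure lborel (ball 0 1)) borel (f \<circ> (\<lambda>x. x /\<^sub>R norm x))"
    unfolding uniform_sphere_def by (rule distr_distr) auto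
  also have "f \<circ> (\<lambda>x. x /\<^sub>R norm x) = (\<lambda>x. x /\<^sub>R norm x) \<circ> f"
    by (auto simp: fun_eq_iff orthogonal_transformation_norm[OF f] orthogonal_transformation_scaleR[OF f])
  also have "distr (uniform_measure lborel (ball 0 1)) borel \<dots> =
      distr (distr (uniform_measure lborel (ball 0 1)) borel f) borel (\<lambda>x. x /\<^sub>R norm x)"
    by (rule distr_distr[symmetric]) auto
  finally show ?thesis
    by (simp add: distr_uniform_ball_orthogonal[OF f] uniform_sphere_def)
qed

lemma sets_uniform_sphere [simp, measurable_cong]: "sets uniform_sphere = sets borel"
  by (simp add: uniform_sphere_def)

lemma space_uniform_sphere [simp]: "space uniform_sphere = UNIV"
  by (simp add: uniform_sphere_def)

interpretation uniform_sphere: prob_space uniform_sphere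
proof -
  have "emeasure lborel (ball 0 1 :: (real ^ 3) set) \<noteq> 0"
    using content_ball_pos[of 1 "0 :: real ^ 3"] by (auto simp: measure_def)
  moreover have "emeasure lborel (ball 0 1 :: (real ^ 3) set) \<noteq> \<infinity>"
    using emeasure_lborel_ball_finite[of "0 :: real ^ 3" 1] by simp
  ultimately have "prob_space (uniform_measure lborel (ball 0 1 :: (real ^ 3) set))"
    by (rule prob_space_uniform_measure)
  then show "prob_space uniform_sphere"
    unfolding uniform_sphere_def by (rule prob_space.prob_space_distr) simp
qed

text \<open>Normalisation fails only at the origin, which is a null set of the ball.\<close>

lemma AE_uniform_sphere_norm: "AE u in uniform_sphere. norm u = 1"
proof -
  have "AE x in uniform_measure lborel (ball 0 1 :: (real ^ 3) set). norm (x /\<^sub>R norm x) = 1"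
    by (rule AE_uniform_measureI) (use AE_lborel_singleton[of "0 :: real ^ 3"] in auto)
  then show ?thesis
    unfolding uniform_sphere_def by (subst AE_distr_iff) auto
qed

lemma integral_uniform_sphere_orthogonal:
  fixes g :: "real ^ 3 \<Rightarrow> 'b :: {banach, second_countable_topology}"
  assumes "orthogonal_transformation f" and [measurable]: "g \<in> borel_measurable borel"
  shows "(\<integral>u. g (f u) \<partial>uniform_sphere) = (\<integral>u. g u \<partial>uniform_sphere)"
proof -
  have [measurable]: "f \<in> borel_measurable borel"
    using assms by (intro borel_measurable_continuous_onI linear_continuous_on
        linear_conv_bounded_linear[THEN iffD1] orthogonal_transformation_linear)
  have "(\<integral>u. g u \<partial>distr uniform_sphere borel f) = (\<integral>u. g (f u) \<partial>uniform_sphere)"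
    by (rule integral_distr) auto
  then show ?thesis
    by (simp add: distr_uniform_sphere_orthogonal assms)
qed

lemma integrable_uniform_sphere:
  fixes g :: "real ^ 3 \<Rightarrow> 'b :: {banach, second_countable_topology}"
  assumes "\<And>u. norm u = 1 \<Longrightarrow> norm (g u) \<le> B" and "g \<in> borel_measurable borel"
  shows "integrable uniform_sphere g"
  by (rule uniform_sphere.integrable_const_bound[where B = B])
     (use AE_uniform_sphere_norm assms in auto)

text \<open>Some orthogonal map sends \<open>norm v\<close> times \<open>e\<close> to
  \<open>v\<close>; by invariance only the length of \<open>v\<close> matters.\<close>

lemma uniform_sphere_moment_norm:
  fixes e :: "real ^ 3"
  assumes "norm e = 1"
  shows "(\<integral>u. (u \<bullet> v) ^ n \<partial>uniform_sphere) = norm v ^ n * (\<integral>u. (u \<bullet> e) ^ n \<partial>uniform_sphere)"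
proof -
  obtain f where f: "orthogonal_transformation f" "f (norm v *\<^sub>R e) = v"
    using orthogonal_transformation_exists[of "norm v *\<^sub>R e" v] assms by auto
  have "(\<integral>u. (u \<bullet> v) ^ n \<partial>uniform_sphere) = (\<integral>u. (f u \<bullet> f (norm v *\<^sub>R e)) ^ n \<partial>uniform_sphere)"
    unfolding f(2) by (rule integral_uniform_sphere_orthogonal[symmetric, OF f(1)]) simp
  also have "\<dots> = (\<integral>u. norm v ^ n * (u \<bullet> e) ^ n \<partial>uniform_sphere)"
    using f(1) by (simp add: orthogonal_transformation_def power_mult_distrib)
  finally show ?thesis by simp
qed

lemma coeff_one_plus_square_power:
  "coeff ([:1, 0, 1:] ^ m :: real poly) 0 = 1 \<and> coeff ([:1, 0, 1:] ^ m :: real poly) (Suc 0) = 0 \<and>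
   coeff ([:1, 0, 1:] ^ m :: real poly) 2 = real m"
  by (induction m) (auto simp: numeral_2_eq_2)

text \<open>
  Comparing the coefficients of \<open>s\<^sup>2\<close> in
  \<open>\<integral>(u\<^sub>1 + s u\<^sub>j)\<^sup>2\<^sup>m = (1 + s\<^sup>2)\<^sup>m \<integral>u\<^sub>1\<^sup>2\<^sup>m\<close> gives a recurrence for the moments.
\<close>
lemma uniform_sphere_mixed_moment:
  fixes j :: 3
  assumes "j \<noteq> 1"
  shows "real (2 * m + 1) * (\<integral>u. (u $ 1) ^ (2 * m) * (u $ j)\<^sup>2 \<partial>uniform_sphere) =
    (\<integral>u. (u $ 1) ^ (2 * m + 2) \<partial>uniform_sphere)"
proof -
  define n where "n = 2 * m + 2"
  define I where "I = (\<integral>u. (u $ 1) ^ n \<partial>uniform_sphere)"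
  define a where "a k = (\<integral>u. (u $ 1) ^ (n - k) * (u $ j) ^ k \<partial>uniform_sphere)" for k
  have int: "integrable uniform_sphere (\<lambda>u. (u $ 1) ^ (n - k) * (u $ j) ^ k)" for k
  proof (rule integrable_uniform_sphere[where B = 1])
    fix u :: "real ^ 3" assume "norm u = 1"
    then have "\<bar>u $ i\<bar> \<le> 1" for i
      using component_le_norm_cart[of u i] by simp
    then show "norm ((u $ 1) ^ (n - k) * (u $ j) ^ k) \<le> 1"
      by (simp add: abs_mult power_abs mult_le_one power_le_one)
  qed simp
  define p where "p = (\<Sum>k\<le>n. monom (real (n choose k) * a k) k)"
  have "poly p s = poly (smult I ([:1, 0, 1:] ^ (m + 1))) s" for s
  proof -
    define v :: "real ^ 3" where "v = axis 1 1 + s *\<^sub>R axis j 1"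
    have uv: "u \<bullet> v = s * u $ j + u $ 1" for u
      by (simp add: v_def inner_add_right inner_axis)
    have "v \<bullet> v = s\<^sup>2 + 1"
      using assms unfolding uv by (simp add: v_def axis_def power2_eq_square)
    then have norm: "norm v ^ 2 = s\<^sup>2 + 1"
      by (simp add: power2_norm_eq_inner)
    have "poly p s = (\<Sum>k\<le>n. (\<integral>u. real (n choose k) * (s * u $ j) ^ k * (u $ 1) ^ (n - k) \<partial>uniform_sphere))"
      unfolding p_def poly_sum poly_monom a_def
      by (intro sum.cong refl)
         (simp add: power_mult_distrib mult_ac flip: integral_mult_right_zero)
    also have "\<dots> = (\<integral>u. (u \<bullet> v) ^ n \<partial>uniform_sphere)"
      unfolding uv binomial_ring
    proof (rule Bochner_Integration.integral_sum[symmetric])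
      fix k
      show "integrable uniform_sphere (\<lambda>u. real (n choose k) * (s * u $ j) ^ k * (u $ 1) ^ (n - k))"
        using integrable_mult_right[OF int[of k], of "real (n choose k) * s ^ k"]
        by (simp add: power_mult_distrib mult_ac)
    qed
    also have "\<dots> = norm v ^ n * (\<integral>u. (u \<bullet> axis 1 1) ^ n \<partial>uniform_sphere)"
      by (rule uniform_sphere_moment_norm) simp
    also have "norm v ^ n = (norm v ^ 2) ^ (m + 1)"
      by (simp only: n_def power_mult[symmetric] distrib_left mult_1_right)
    also have "(norm v ^ 2) ^ (m + 1) * (\<integral>u. (u \<bullet> axis 1 1) ^ n \<partial>uniform_sphere) =
        poly (smult I ([:1, 0, 1:] ^ (m + 1))) s"
      unfolding norm I_def by (simp add: inner_axis power2_eq_square algebra_simps)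
    finally show ?thesis .
  qed
  then have "poly p = poly (smult I ([:1, 0, 1:] ^ (m + 1)))"
    by (rule ext)
  then have "p = smult I ([:1, 0, 1:] ^ (m + 1))"
    by (simp only: poly_eq_poly_eq_iff)
  then have "coeff p 2 = I * real (m + 1)"
    using coeff_one_plus_square_power[of "m + 1"] by simp
  moreover have "coeff p 2 = real (n choose 2) * a 2"
  proof -
    have "2 \<le> n" by (simp add: n_def)
    then show ?thesis
      unfolding p_def coeff_sum coeff_monom by simp
  qed
  \<comment> \<open>The factor \<open>m + 1\<close> cancels against the coefficient of
    \<open>s^2\<close> in \<open>(1 + s^2)^(m+1)\<close>.\<close>
  moreover have "real (n choose 2) = real (m + 1) * real (2 * m + 1)"
    unfolding n_def choose_two by (simp add: algebra_simps)
  ultimately have "real (2 * m + 1) * a 2 = I"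
    by simp
  then show ?thesis by (simp add: a_def I_def n_def)
qed

text \<open>Inserting \<open>u1^2 + u2^2 + u3^2 = 1\<close> into the moment \<open>I m\<close> and
  applying the mixed moments gives \<open>I m = I (m+1) + 2 I (m+1) / (2m+1)\<close>, that is
  \<open>(2m+1) I m = (2m+3) I (m+1)\<close>. These are the moments of the uniform distribution on
  \<open>[-1, 1]\<close>, as Archimedes' theorem on the sphere predicts.\<close>

lemma uniform_sphere_even_moment:
  "(\<integral>u. (u $ 1) ^ (2 * m) \<partial>uniform_sphere) = 1 / (2 * real m + 1)"
proof (induction m)
  case 0
  show ?case using uniform_sphere.prob_space by simp
next
  case (Suc m)
  define I where "I m = (\<integral>u. (u $ 1) ^ (2 * m) \<partial>uniform_sphere)" for m
  have int: "integrable uniform_sphere (\<lambda>u. (u $ 1) ^ n * (u $ j) ^ k)" for n j k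
  proof (rule integrable_uniform_sphere[where B = 1])
    fix u :: "real ^ 3" assume "norm u = 1"
    then have "\<bar>u $ i\<bar> \<le> 1" for i
      using component_le_norm_cart[of u i] by simp
    then show "norm ((u $ 1) ^ n * (u $ j) ^ k) \<le> 1"
      by (simp add: abs_mult power_abs mult_le_one power_le_one)
  qed simp
  have "I m = (\<integral>u. (u $ 1) ^ (2 * m) * (u $ 1)\<^sup>2 + (u $ 1) ^ (2 * m) * (u $ 2)\<^sup>2
      + (u $ 1) ^ (2 * m) * (u $ 3)\<^sup>2 \<partial>uniform_sphere)"
    unfolding I_def
  proof (rule integral_cong_AE)
    have "(u $ 1)\<^sup>2 + (u $ 2)\<^sup>2 + (u $ 3)\<^sup>2 = 1" if "norm u = 1" for u :: "real ^ 3"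
      using that by (simp add: norm_eq_1 inner_vec_def sum_3 power2_eq_square)
    then have "(u $ 1) ^ (2 * m) = (u $ 1) ^ (2 * m) * (u $ 1)\<^sup>2 + (u $ 1) ^ (2 * m) * (u $ 2)\<^sup>2
      + (u $ 1) ^ (2 * m) * (u $ 3)\<^sup>2" if "norm u = 1" for u :: "real ^ 3"
      using that by (simp flip: distrib_left)
    then show "AE u in uniform_sphere. (u $ 1) ^ (2 * m) = (u $ 1) ^ (2 * m) * (u $ 1)\<^sup>2 + (u $ 1) ^ (2 * m) * (u $ 2)\<^sup>2
      + (u $ 1) ^ (2 * m) * (u $ 3)\<^sup>2"
      using AE_uniform_sphere_norm by auto
  qed measurable
  also have "\<dots> = I (Suc m) + (\<integral>u. (u $ 1) ^ (2 * m) * (u $ 2)\<^sup>2 \<partial>uniform_sphere) +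
      (\<integral>u. (u $ 1) ^ (2 * m) * (u $ 3)\<^sup>2 \<partial>uniform_sphere)"
    using int[of "2 * m" _ 2] by (simp add: I_def power2_eq_square mult_ac)
  finally have "real (2 * m + 1) * I m = (2 * real m + 3) * I (Suc m)"
    using uniform_sphere_mixed_moment[of 2 m] uniform_sphere_mixed_moment[of 3 m]
    by (simp add: I_def algebra_simps)
  then show ?case
    using Suc by (simp add: I_def field_simps)
qed

text \<open>The sine part vanishes under \<open>u -> -u\<close>, and the cosine series is integrated
  term by term. The value is \<open>sin (norm v) / norm v\<close>; as a series it covers
  \<open>v = 0\<close> without a case distinction.\<close>

lemma uniform_sphere_char_fun:
  "(\<integral>u. iexp (v \<bullet> u) \<partial>uniform_sphere) =
     complex_of_real (\<Sum>m. (-1) ^ m * norm v ^ (2 * m) / fact (2 * m + 1))"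
proof -
  have mom: "(\<integral>u. (v \<bullet> u) ^ (2 * m) \<partial>uniform_sphere) = norm v ^ (2 * m) / (2 * real m + 1)" for m
    using uniform_sphere_moment_norm[of "axis 1 1" v "2 * m"]
    by (simp add: inner_axis uniform_sphere_even_moment inner_commute)
  have vu: "\<bar>v \<bullet> u\<bar> ^ k \<le> norm v ^ k" if "norm u = 1" for u k
    using Cauchy_Schwarz_ineq2[of v u] that by (intro power_mono) auto
  have int: "integrable uniform_sphere (\<lambda>u. (v \<bullet> u) ^ (2 * m))" for m
    by (rule integrable_uniform_sphere[where B = "norm v ^ (2 * m)"]) (use vu in \<open>auto simp: power_abs\<close>)
  have int_trig: "integrable uniform_sphere (\<lambda>u. cos (v \<bullet> u))" "integrable uniform_sphere (\<lambda>u. sin (v \<bullet> u))"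
    by (rule integrable_uniform_sphere[where B = 1]; simp)+
  have "(\<integral>u. sin (v \<bullet> u) \<partial>uniform_sphere) = (\<integral>u. sin (v \<bullet> - u) \<partial>uniform_sphere)"
    by (rule integral_uniform_sphere_orthogonal[symmetric])
       (auto simp: orthogonal_transformation_def linear_iff)
  then have sin: "(\<integral>u. sin (v \<bullet> u) \<partial>uniform_sphere) = 0"
    by simp
  define f where "f m u = (-1) ^ m / fact (2 * m) * (v \<bullet> u) ^ (2 * m)" for m :: nat and u
  have "(\<integral>u. (\<Sum>m. f m u) \<partial>uniform_sphere) = (\<Sum>m. \<integral>u. f m u \<partial>uniform_sphere)"
  proof (rule integral_suminf)
    show "integrable uniform_sphere (f m)" for m
      unfolding f_def using int by simp
    have s: "summable (\<lambda>m. norm v ^ (2 * m) / fact (2 * m))"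
    proof (rule summable_comparison_test'[OF summable_power_over_fact[of "norm v ^ 2"], where N = 0])
      fix m
      have "fact m \<le> (fact (2 * m) :: real)" by (rule fact_mono) simp
      then show "norm (norm v ^ (2 * m) / fact (2 * m)) \<le> (norm v ^ 2) ^ m / fact m"
        by (auto simp: power_mult intro!: divide_left_mono)
    qed
    show "AE u in uniform_sphere. summable (\<lambda>m. norm (f m u))"
      using AE_uniform_sphere_norm
    proof eventually_elim
      case (elim u)
      show ?case
        by (rule summable_comparison_test'[OF s, where N = 0])
           (use vu[OF elim] in \<open>auto simp: f_def abs_mult power_abs divide_right_mono\<close>)
    qed
    show "summable (\<lambda>m. \<integral>u. norm (f m u) \<partial>uniform_sphere)"
    proof (rule summable_comparison_test'[OF s, where N = 0])
      fix m
      have "(\<integral>u. norm (f m u) \<partial>uniform_sphere) \<le> (\<integral>u. norm v ^ (2 * m) / fact (2 * m) \<partial>uniform_sphere)"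
      proof (rule integral_mono_AE)
        show "integrable uniform_sphere (\<lambda>u. norm (f m u))"
          unfolding f_def using int by simp
        show "AE u in uniform_sphere. norm (f m u) \<le> norm v ^ (2 * m) / fact (2 * m)"
          using AE_uniform_sphere_norm
          by eventually_elim (use vu in \<open>auto simp: f_def abs_mult power_abs divide_right_mono\<close>)
      qed simp
      then show "norm (\<integral>u. norm (f m u) \<partial>uniform_sphere) \<le> norm v ^ (2 * m) / fact (2 * m)"
        using uniform_sphere.prob_space by (simp add: integral_nonneg_AE)
    qed
  qed
  also have "(\<lambda>u. \<Sum>m. f m u) = (\<lambda>u. cos (v \<bullet> u))"
    unfolding f_def using cos_paired by (intro ext sums_unique[symmetric]) auto
  also have "(\<lambda>m. \<integral>u. f m u \<partial>uniform_sphere) = (\<lambda>m. (-1) ^ m * norm v ^ (2 * m) / fact (2 * m + 1))"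
  proof
    fix m
    have "(\<integral>u. f m u \<partial>uniform_sphere) = (-1) ^ m / fact (2 * m) * (norm v ^ (2 * m) / (2 * real m + 1))"
      unfolding f_def by (simp only: integral_mult_right_zero mom)
    then show "(\<integral>u. f m u \<partial>uniform_sphere) = (-1) ^ m * norm v ^ (2 * m) / fact (2 * m + 1)"
      by (simp add: mult_ac)
  qed
  finally have cos: "(\<integral>u. cos (v \<bullet> u) \<partial>uniform_sphere) = (\<Sum>m. (-1) ^ m * norm v ^ (2 * m) / fact (2 * m + 1))" .
  have "iexp (v \<bullet> u) = of_real (cos (v \<bullet> u)) + \<i> * of_real (sin (v \<bullet> u))" for u
    by (simp add: cis_conv_exp[symmetric] complex_eq_iff cos_of_real sin_of_real)
  then show ?thesis
    using int_trig by (simp add: cos sin)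
qed

section \<open>Power series of the inverse functions\<close>

unbundle no vec_syntax and fps_syntax

text \<open>
  With \<open>y = s\<^sup>2\<close> as the variable, the series below are those of \<open>(1 - y) powr (- a)\<close>,
  \<open>- y / (1 - y)\<close>, \<open>artanh s / s\<close>, \<open>arcsin s / s\<close> and \<open>arcsin s / (s sqrt (1 - s\<^sup>2))\<close>.
\<close>

definition rising_fps :: "real \<Rightarrow> real fps" where
  "rising_fps a = Abs_fps (\<lambda>n. pochhammer a n / fact n)"

definition mobius_fps :: "real fps" where
  "mobius_fps = - (fps_X * rising_fps 1)"

definition artanh_fps :: "real fps" where
  "artanh_fps = Abs_fps (\<lambda>m. 1 / (2 * real m + 1))"

definition arcsin_fps :: "real fps" where
  "arcsin_fps = Abs_fps (\<lambda>m. pochhammer (1/2) m / (fact m * (2 * real m + 1)))"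

definition arcsin_deriv_fps :: "real fps" where
  "arcsin_deriv_fps = Abs_fps (\<lambda>m. fact m / pochhammer (3/2) m)"

section \<open>Powers of \<open>1 - y\<close> and the Moebius substitution
  \<open>y -> -y / (1 - y)\<close>\<close>

lemma rising_fps_nth [simp]: "rising_fps a $ n = pochhammer a n / fact n"
  by (simp add: rising_fps_def)

lemma one_minus_fps_X_deriv_nth:
  "((1 - fps_X) * fps_deriv F) $ n = real (n + 1) * F $ Suc n - real n * F $ n"
  by (cases n) (simp_all add: algebra_simps)

lemma rising_fps_ode: "(1 - fps_X) * fps_deriv (rising_fps a) = fps_const a * rising_fps a"
proof (rule fps_ext)
  fix n
  have "real (n + 1) * rising_fps a $ Suc n = (a + real n) * rising_fps a $ n"
    by (simp add: pochhammer_Suc divide_simps)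
  then show "((1 - fps_X) * fps_deriv (rising_fps a)) $ n = (fps_const a * rising_fps a) $ n"
    unfolding one_minus_fps_X_deriv_nth by (simp add: algebra_simps add_divide_distrib)
qed

text \<open>The equation is a first-order recurrence for the coefficients, hence determines
  \<open>F\<close> up to its constant term. The rules for products and for substitution below are
  proved by verifying this equation.\<close>

lemma rising_fps_unique:
  assumes "(1 - fps_X) * fps_deriv F = fps_const a * F"
  shows "F = fps_const (F $ 0) * rising_fps a"
proof (rule fps_ext)
  fix n show "F $ n = (fps_const (F $ 0) * rising_fps a) $ n"
  proof (induction n)
    case (Suc n)
    have "((1 - fps_X) * fps_deriv F) $ n = a * F $ n"
      by (simp add: assms)
    then have "F $ Suc n = (a + real n) * F $ n / real (n + 1)"
      unfolding one_minus_fps_X_deriv_nth by (simp add: field_simps)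
    then show ?case by (simp add: Suc pochhammer_Suc mult_ac)
  qed simp
qed

lemma rising_fps_0 [simp]: "rising_fps 0 = 1"
  by (rule fps_ext) (auto simp: pochhammer_0_left)

lemma rising_fps_minus_1: "rising_fps (-1) = 1 - fps_X"
proof -
  have "(1 - fps_X) * fps_deriv (1 - fps_X :: real fps) = fps_const (-1) * (1 - fps_X)"
    by (simp flip: fps_const_neg)
  from rising_fps_unique[OF this] show ?thesis by simp
qed

lemma rising_fps_add: "rising_fps a * rising_fps b = rising_fps (a + b)"
proof -
  have "(1 - fps_X) * fps_deriv (rising_fps a * rising_fps b) =
      ((1 - fps_X) * fps_deriv (rising_fps a)) * rising_fps b
      + rising_fps a * ((1 - fps_X) * fps_deriv (rising_fps b))"
    by (simp add: algebra_simps)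
  also have "\<dots> = fps_const a * rising_fps a * rising_fps b + rising_fps a * (fps_const b * rising_fps b)"
    by (simp only: rising_fps_ode)
  also have "\<dots> = fps_const (a + b) * (rising_fps a * rising_fps b)"
    by (simp add: algebra_simps del: fps_const_add flip: fps_const_add)
  finally show ?thesis using rising_fps_unique by fastforce
qed

lemma rising_fps_power: "rising_fps a ^ n = rising_fps (real n * a)"
  by (induction n) (simp_all add: rising_fps_add algebra_simps)

lemma rising_fps_1_mult: "(1 - fps_X) * rising_fps 1 = 1"
  using rising_fps_add[of "-1" 1] by (simp add: rising_fps_minus_1)

lemma rising_fps_deriv: "fps_deriv (rising_fps a) = fps_const a * rising_fps a * rising_fps 1"
proof -
  have "fps_deriv (rising_fps a) = (1 - fps_X) * rising_fps 1 * fps_deriv (rising_fps a)"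
    by (simp add: rising_fps_1_mult)
  also have "\<dots> = rising_fps 1 * ((1 - fps_X) * fps_deriv (rising_fps a))"
    by (simp only: mult_ac)
  also have "\<dots> = fps_const a * rising_fps a * rising_fps 1"
    unfolding rising_fps_ode by (simp only: mult_ac)
  finally show ?thesis .
qed

lemma mobius_fps_nth_0 [simp]: "mobius_fps $ 0 = 0"
  by (simp add: mobius_fps_def)

lemma mobius_fps_deriv: "fps_deriv mobius_fps = - (rising_fps 1 ^ 2)"
proof -
  have "fps_deriv mobius_fps = - rising_fps 1 - fps_X * rising_fps 1 * rising_fps 1"
    by (simp add: mobius_fps_def rising_fps_deriv algebra_simps)
  also have "\<dots> = - ((1 - fps_X) * rising_fps 1) * rising_fps 1 - fps_X * rising_fps 1 * rising_fps 1"
    unfolding rising_fps_1_mult by simp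
  finally show ?thesis by (simp add: algebra_simps power2_eq_square)
qed

lemma one_minus_mobius_fps: "1 - mobius_fps = rising_fps 1"
proof -
  have "1 - mobius_fps = (1 - fps_X) * rising_fps 1 + fps_X * rising_fps 1"
    unfolding rising_fps_1_mult by (simp add: mobius_fps_def)
  then show ?thesis by (simp add: algebra_simps)
qed

lemma mobius_fps_power: "mobius_fps ^ k = fps_const ((-1) ^ k) * fps_X ^ k * rising_fps (real k)"
proof -
  have "mobius_fps = fps_const (-1) * fps_X * rising_fps 1"
    by (simp add: mobius_fps_def flip: fps_const_neg)
  then have "mobius_fps ^ k = (fps_const (-1) * fps_X * rising_fps 1) ^ k"
    by (simp only:)
  also have "\<dots> = fps_const ((-1) ^ k) * fps_X ^ k * rising_fps (real k)"
    by (simp only: power_mult_distrib fps_const_power rising_fps_power mult_1_right)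
  finally show ?thesis .
qed

text \<open>With \<open>w = -y / (1 - y)\<close> one has \<open>1 - w = 1 / (1 - y)\<close>, so the
  exponent changes its sign. The chain rule turns the differential equation for \<open>a\<close>
  into the one for \<open>-a\<close>.\<close>

lemma rising_fps_mobius: "rising_fps a oo mobius_fps = rising_fps (- a)"
proof -
  define F where "F = rising_fps a oo mobius_fps"
  define D where "D = fps_deriv (rising_fps a) oo mobius_fps"
  have "((1 - fps_X) * fps_deriv (rising_fps a)) oo mobius_fps
      = (fps_const a * rising_fps a) oo mobius_fps"
    by (simp only: rising_fps_ode)
  then have D: "rising_fps 1 * D = fps_const a * F"
    by (simp add: fps_compose_mult_distrib fps_compose_sub_distrib F_def D_def
        one_minus_mobius_fps)
  have "(1 - fps_X) * fps_deriv F = - ((1 - fps_X) * rising_fps 1) * (rising_fps 1 * D)"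
    by (simp add: F_def D_def fps_compose_deriv mobius_fps_deriv power2_eq_square algebra_simps)
  also have "\<dots> = fps_const (- a) * F"
    unfolding rising_fps_1_mult D by (simp flip: fps_const_neg)
  finally have "F = fps_const (F $ 0) * rising_fps (- a)"
    by (rule rising_fps_unique)
  then show ?thesis by (simp add: F_def)
qed

text \<open>This is the derivative of \<open>arcsin s\<close>: for
  \<open>arcsin s = s E(s^2)\<close> the derivative in \<open>s\<close> is
  \<open>2 y E'(y) + E(y)\<close> at \<open>y = s^2\<close>, and it equals
  \<open>(1 - y)^(-1/2)\<close>.\<close>

lemma arcsin_fps_ode: "2 * fps_X * fps_deriv arcsin_fps + arcsin_fps = rising_fps (1/2)"
proof (rule fps_ext)
  fix n show "(2 * fps_X * fps_deriv arcsin_fps + arcsin_fps) $ n = rising_fps (1/2) $ n"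
    by (cases n) (simp_all add: arcsin_fps_def mult.assoc numeral_fps_const divide_simps,
      simp add: algebra_simps)
qed

text \<open>This is \<open>artanh x = arsinh (x / sqrt (1 - x\<^sup>2))\<close>, as \<open>arsinh s = - \<i> arcsin (\<i> s)\<close>.\<close>
lemma artanh_fps_arcsin_fps: "artanh_fps = rising_fps (1/2) * (arcsin_fps oo mobius_fps)"
proof -
  define Q where "Q = rising_fps (1/2)"
  define P where "P = rising_fps 1"
  define Ew where "Ew = arcsin_fps oo mobius_fps"
  define Dw where "Dw = fps_deriv arcsin_fps oo mobius_fps"
  have P: "(1 - fps_X) * P = 1"
    unfolding P_def by (rule rising_fps_1_mult)
  have "(2 * fps_X * fps_deriv arcsin_fps + arcsin_fps) oo mobius_fps = Q oo mobius_fps"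
    by (simp only: arcsin_fps_ode Q_def)
  then have ode: "2 * mobius_fps * Dw + Ew = rising_fps (-1/2)"
    by (simp add: fps_compose_add_distrib fps_compose_mult_distrib Ew_def Dw_def Q_def
        rising_fps_mobius numeral_fps_const)
  have w: "mobius_fps = - (fps_X * P)"
    by (simp add: mobius_fps_def P_def)
  define G where "G = Q * Ew"
  have half: "2 * fps_const (1/2 :: real) = 1"
    by (simp add: numeral_fps_const)
  have dG: "fps_deriv G = fps_const (1/2) * Q * P * Ew - Q * Dw * P ^ 2"
    by (simp add: G_def Q_def P_def Ew_def Dw_def rising_fps_deriv fps_compose_deriv
        mobius_fps_deriv algebra_simps)
  \<comment> \<open>The target \<open>2 y G' + G = 1 / (1 - y)\<close> expresses in the same way
    that \<open>x G(x^2)\<close> has the derivative \<open>1 / (1 - x^2)\<close> of artanh.\<close>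
  have "2 * fps_X * fps_deriv G + G
      = (2 * fps_const (1/2)) * fps_X * Q * P * Ew - 2 * fps_X * Q * Dw * P ^ 2
        + Q * ((1 - fps_X) * P) * Ew"
    unfolding P dG by (simp add: G_def algebra_simps)
  also have "\<dots> = Q * P * (2 * mobius_fps * Dw + Ew)"
    unfolding half w by (simp add: algebra_simps power2_eq_square)
  also have "\<dots> = Q * rising_fps (-1/2) * P"
    unfolding ode by (simp only: mult_ac)
  also have "\<dots> = P"
    by (simp add: Q_def rising_fps_add)
  finally have G: "2 * fps_X * fps_deriv G + G = P" .
  have "artanh_fps $ n = G $ n" for n
  proof -
    \<comment> \<open>The operator multiplies coefficient \<open>n\<close> by \<open>2n + 1\<close>,
      and every coefficient of \<open>1 / (1 - y)\<close> is 1.\<close>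
    have "(2 * fps_X * fps_deriv G + G) $ n = (2 * real n + 1) * G $ n"
      by (cases n) (simp_all add: mult.assoc numeral_fps_const algebra_simps)
    then have "(2 * real n + 1) * G $ n = 1"
      by (simp add: G P_def flip: pochhammer_fact)
    then show ?thesis by (simp add: artanh_fps_def field_simps)
  qed
  then show ?thesis by (simp add: fps_eq_iff G_def Q_def Ew_def)
qed

text \<open>The \<open>k\<close>-th power of the substituted series times
  \<open>(1 - y)^(-b)\<close> is \<open>(-1)^k y^k (1 - y)^(-k-b)\<close>, which contributes a
  single Pochhammer quotient and nothing below order \<open>k\<close>; therefore the sum stops at
  \<open>N\<close>.\<close>

lemma rising_fps_mult_mobius_nth:
  "(rising_fps b * (F oo mobius_fps)) $ N =
     (\<Sum>k\<le>N. (-1) ^ k * F $ k * pochhammer (real k + b) (N - k) / fact (N - k))"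
proof -
  have z: "(mobius_fps ^ k) $ i = 0" if "i < k" for i k
    using that unfolding mobius_fps_power mult.assoc fps_mult_left_const_nth
    by (simp add: fps_X_power_mult_nth)
  have "(F oo mobius_fps) $ i = (\<Sum>k\<le>N. F $ k * (mobius_fps ^ k) $ i)" if "i \<le> N" for i
    unfolding fps_compose_nth using that z
    by (intro sum.mono_neutral_left) auto
  then have "(rising_fps b * (F oo mobius_fps)) $ N =
      (\<Sum>i=0..N. rising_fps b $ i * (\<Sum>k\<le>N. F $ k * (mobius_fps ^ k) $ (N - i)))"
    unfolding fps_mult_nth by (intro sum.cong) auto
  also have "\<dots> = (\<Sum>k\<le>N. F $ k * (rising_fps b * mobius_fps ^ k) $ N)"
    unfolding fps_mult_nth sum_distrib_left by (subst sum.swap) (simp add: mult_ac)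
  also have "\<dots> = (\<Sum>k\<le>N. (-1) ^ k * F $ k * pochhammer (real k + b) (N - k) / fact (N - k))"
  proof (rule sum.cong)
    fix k assume "k \<in> {..N}"
    have "rising_fps b * mobius_fps ^ k = fps_const ((-1) ^ k) * (fps_X ^ k * rising_fps (real k + b))"
      by (simp add: mobius_fps_power algebra_simps flip: rising_fps_add)
    then show "F $ k * (rising_fps b * mobius_fps ^ k) $ N =
        (-1) ^ k * F $ k * pochhammer (real k + b) (N - k) / fact (N - k)"
      using \<open>k \<in> {..N}\<close> by (simp add: fps_X_power_mult_nth)
  qed simp
  finally show ?thesis .
qed

text \<open>Each of the \<open>p\<close> factors contributes \<open>(1 - y)^(-1/2)\<close>, hence
  the shift by \<open>p / 2\<close>.\<close>

lemma artanh_fps_power_nth: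
  "(artanh_fps ^ p) $ N =
     (\<Sum>k\<le>N. (-1) ^ k * (arcsin_fps ^ p) $ k * pochhammer (real k + real p / 2) (N - k)
        / fact (N - k))"
proof -
  have "artanh_fps ^ p = rising_fps (real p / 2) * (arcsin_fps ^ p oo mobius_fps)"
    by (simp add: artanh_fps_arcsin_fps power_mult_distrib rising_fps_power fps_compose_power)
  then show ?thesis by (simp add: rising_fps_mult_mobius_nth)
qed

text \<open>The product satisfies a linear differential equation that, cleared of
  \<open>1 / (1 - y)\<close>, becomes \<open>(2n+3) R (n+1) = 2 (n+1) R n\<close>, the recurrence of
  \<open>n! / (3/2)_n\<close>.\<close>

lemma arcsin_deriv_fps_eq: "arcsin_deriv_fps = rising_fps (1/2) * arcsin_fps"
proof -
  define Q where "Q = rising_fps (1/2)"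
  define P where "P = rising_fps 1"
  define R where "R = Q * arcsin_fps"
  have P: "(1 - fps_X) * P = 1"
    unfolding P_def by (rule rising_fps_1_mult)
  have QQ: "Q * Q = P"
    by (simp add: Q_def P_def rising_fps_add)
  have half: "2 * fps_const (1/2 :: real) = 1"
    by (simp add: numeral_fps_const)
  have "fps_deriv R = fps_const (1/2) * P * R + Q * fps_deriv arcsin_fps"
    by (simp add: R_def Q_def P_def rising_fps_deriv algebra_simps)
  then have "2 * fps_X * fps_deriv R + R = (2 * fps_const (1/2)) * fps_X * P * R
      + Q * (2 * fps_X * fps_deriv arcsin_fps + arcsin_fps)"
    by (simp add: R_def algebra_simps)
  also have "\<dots> = fps_X * P * R + P"
    unfolding half arcsin_fps_ode by (simp flip: Q_def add: QQ)
  finally have "(1 - fps_X) * (2 * fps_X * fps_deriv R + R) = ((1 - fps_X) * P) * (fps_X * R + 1)"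
    by (simp add: algebra_simps)
  then have *: "2 * fps_X * fps_deriv R + R = 2 * fps_X * (fps_X * fps_deriv R + R) + 1"
    unfolding P by (simp add: algebra_simps)
  have "R $ n = arcsin_deriv_fps $ n" for n
  proof (induction n)
    case 0
    show ?case by (simp add: R_def Q_def arcsin_fps_def arcsin_deriv_fps_def)
  next
    case (Suc n)
    have "(2 * fps_X * fps_deriv R + R) $ Suc n = (2 * fps_X * (fps_X * fps_deriv R + R) + 1) $ Suc n"
      by (simp only: *)
    then have "(2 * real n + 3) * R $ Suc n = 2 * (real n + 1) * R $ n"
      by (cases n) (simp_all add: mult.assoc numeral_fps_const algebra_simps)
    then have "R $ Suc n = (real n + 1) * R $ n / (3/2 + real n)"
      by (simp add: field_simps)
    then show ?case
      unfolding Suc by (simp add: arcsin_deriv_fps_def pochhammer_Suc)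
  qed
  then show ?thesis by (simp add: fps_eq_iff R_def Q_def)
qed

section \<open>Coefficients of the second and fourth power of \<open>arcsin s / s\<close>\<close>

lemma fps_X_deriv_nth: "(fps_X * fps_deriv F) $ n = of_nat n * (F :: real fps) $ n"
  by (cases n) simp_all

text \<open>The derivative of \<open>(arcsin s)^2\<close> is
  \<open>2 arcsin s / sqrt (1 - s^2)\<close>; integrating back divides the coefficient of
  \<open>s^(2n+1)\<close> by \<open>2n + 2\<close>.\<close>

lemma arcsin_fps_power2_nth: "(arcsin_fps ^ 2) $ n = arcsin_deriv_fps $ n / (real n + 1)"
proof -
  have "2 * (fps_X * fps_deriv (arcsin_fps ^ 2)) + 2 * arcsin_fps ^ 2 =
      2 * (arcsin_fps * (2 * fps_X * fps_deriv arcsin_fps + arcsin_fps))"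
    by (simp add: power2_eq_square algebra_simps)
  also have "\<dots> = 2 * arcsin_deriv_fps"
    unfolding arcsin_fps_ode arcsin_deriv_fps_eq by (simp only: mult_ac)
  finally have "(2 * (fps_X * fps_deriv (arcsin_fps ^ 2)) + 2 * arcsin_fps ^ 2) $ n
      = (2 * arcsin_deriv_fps) $ n"
    by simp
  then have "(2 * real n + 2) * (arcsin_fps ^ 2) $ n = 2 * arcsin_deriv_fps $ n"
    unfolding numeral_fps_const fps_add_nth fps_mult_left_const_nth fps_X_deriv_nth
    by (simp add: algebra_simps)
  then show ?thesis by (simp add: field_simps)
qed

text \<open>The derivative of \<open>(arcsin s)^4\<close> is four times \<open>(arcsin s)^2\<close>
  times \<open>arcsin s / sqrt (1 - s^2)\<close>. The sum is this Cauchy product, the weight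
  \<open>1 / (j+1)\<close> comes from the square, and integrating back divides by
  \<open>2n + 4\<close>.\<close>

lemma arcsin_fps_power4_nth:
  "(arcsin_fps ^ 4) $ n =
     2 / (real n + 2) *
       (\<Sum>j=0..n. arcsin_deriv_fps $ j * arcsin_deriv_fps $ (n - j) / (real j + 1))"
proof -
  have "2 * (fps_X * fps_deriv (arcsin_fps ^ 4)) + 4 * arcsin_fps ^ 4 =
      4 * arcsin_fps ^ 2 * (arcsin_fps * (2 * fps_X * fps_deriv arcsin_fps + arcsin_fps))"
    by (simp add: algebra_simps eval_nat_numeral)
  also have "\<dots> = 4 * (arcsin_fps ^ 2 * arcsin_deriv_fps)"
    unfolding arcsin_fps_ode arcsin_deriv_fps_eq by (simp only: mult_ac)
  finally have "(2 * (fps_X * fps_deriv (arcsin_fps ^ 4)) + 4 * arcsin_fps ^ 4) $ n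
      = (4 * (arcsin_fps ^ 2 * arcsin_deriv_fps)) $ n"
    by simp
  then have "(2 * real n + 4) * (arcsin_fps ^ 4) $ n =
      4 * (\<Sum>j=0..n. (arcsin_fps ^ 2) $ j * arcsin_deriv_fps $ (n - j))"
    unfolding numeral_fps_const fps_add_nth fps_mult_left_const_nth fps_X_deriv_nth
    unfolding fps_mult_nth[of "arcsin_fps ^ 2"] by (simp add: algebra_simps)
  then show ?thesis
    by (simp add: arcsin_fps_power2_nth field_simps)
qed

section \<open>Rearranging the Bessel series\<close>

lemma pos_notin_nonpos_Ints:
  assumes "x > (0 :: real)"
  shows "x \<notin> \<int>\<^sub>\<le>\<^sub>0"
  using assms nonpos_Ints_nonpos[of x] by auto

lemma Gamma_three_halves: "Gamma (3/2 :: real) = sqrt pi / 2"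
  using Gamma_plus1[of "1/2 :: real"] pos_notin_nonpos_Ints[of "1/2"]
  by (simp add: Gamma_one_half_real)

lemma arcsin_deriv_fps_nth_Gamma:
  "arcsin_deriv_fps $ k = sqrt pi / 2 * (fact k / Gamma (real k + 3/2))"
proof -
  have "pochhammer (3/2) k = Gamma (3/2 + real k) / Gamma (3/2 :: real)"
    by (intro pochhammer_Gamma pos_notin_nonpos_Ints) simp
  then show ?thesis
    by (simp add: arcsin_deriv_fps_def add.commute mult.commute Gamma_three_halves)
qed

text \<open>Both sides contain the same sum once \<open>n! / (3/2)_n\<close> is written with Gamma
  values. The two factors \<open>Gamma (3/2) = sqrt pi / 2\<close> give \<open>pi / 4\<close>, and
  the factor 2 in \<open>arcsin_fps_power4_nth\<close> makes it \<open>pi / 2\<close>.\<close>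

lemma flight_gamma_eq: "flight_gamma k = 2 / pi * (arcsin_fps ^ 4) $ k"
proof -
  have pi: "(sqrt pi / 2) * (sqrt pi / 2) = pi / 4"
    by simp
  have "(\<Sum>j=0..k. arcsin_deriv_fps $ j * arcsin_deriv_fps $ (k - j) / (real j + 1)) =
    (\<Sum>j=0..k. (sqrt pi / 2 * (sqrt pi / 2)) * (fact j * fact (k - j) /
        ((real j + 1) * Gamma (real j + 3/2) * Gamma (real (k - j) + 3/2))))"
    unfolding arcsin_deriv_fps_nth_Gamma by (intro sum.cong refl) (simp only: times_divide_eq_left times_divide_eq_right mult_ac divide_divide_eq_left)
  also have "\<dots> = pi / 4 * ((real k + 2) * flight_gamma k)"
    unfolding pi flight_gamma_def sum_distrib_left[symmetric] by simp
  finally have S: "(\<Sum>j=0..k. arcsin_deriv_fps $ j * arcsin_deriv_fps $ (k - j) / (real j + 1))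
    = pi / 4 * ((real k + 2) * flight_gamma k)" .
  show ?thesis
    unfolding arcsin_fps_power4_nth S by simp
qed

text \<open>All factors are half-integers; so no denominator of the hypergeometric series
  vanishes.\<close>

lemma pochhammer_half_ne_0: "pochhammer (- real k + 1/2) m \<noteq> 0"
proof
  assume "pochhammer (- real k + 1/2) m = 0"
  then obtain i where "- real k + 1/2 = - real i"
    by (auto simp: pochhammer_eq_0_iff)
  then have "real (2 * i + 1) = real (2 * k)" by simp
  then have "2 * i + 1 = 2 * k" by (simp only: of_nat_eq_iff)
  then show False by presburger
qed

text \<open>The series terminates, as \<open>pochhammer (- k) m\<close> vanishes for \<open>m > k\<close>.\<close>
lemma hypergeometric_F_eq_arcsin_fps:
  "hypergeometric_F [1, 1, 1, - real k, - real k - 1/2]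
     [- real k + 1/2, - real k + 1/2, 3/2, 2] 1 / (2 * real k + 1) ^ 2 =
   arcsin_deriv_fps $ k * (arcsin_fps ^ 3) $ k"
proof -
  define R where "R m = arcsin_deriv_fps $ m" for m
  define f where "f m = (\<Prod>a\<leftarrow>[1, 1, 1, - real k, - real k - 1/2]. pochhammer a m) /
    (\<Prod>b\<leftarrow>[- real k + 1/2, - real k + 1/2, 3/2, 2]. pochhammer b m) * 1 ^ m / fact m" for m
  have R0: "R m \<noteq> 0" for m
    by (simp add: R_def arcsin_deriv_fps_def pochhammer_eq_0_iff)
  have E: "arcsin_fps $ j = 1 / ((2 * real j + 1) ^ 2 * R j)" for j
  proof -
    have "pochhammer (1/2) (Suc j) = 1/2 * pochhammer (3/2 :: real) j"
      by (subst pochhammer_rec) simp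
    then have "pochhammer (3/2) j = (2 * real j + 1) * pochhammer (1/2) j"
      by (simp add: pochhammer_Suc field_simps)
    then show ?thesis
      by (simp add: arcsin_fps_def R_def arcsin_deriv_fps_def power2_eq_square)
  qed
  \<comment> \<open>Reversal of the order of the factors: \<open>(-k)_m = (-1)^m k! / (k-m)!\<close>
    and \<open>(-k+1/2)_m = (-1)^m (1/2)_k / (1/2)_(k-m)\<close>, while
    \<open>j! / (1/2)_j = (2j+1) R j\<close>.\<close>
  have A: "pochhammer (- real k) m / pochhammer (- real k + 1/2) m =
      (2 * real k + 1) * R k / ((2 * real (k - m) + 1) * R (k - m))" if "m \<le> k" for m
    using that
  proof (induction m)
    case 0
    then show ?case using R0[of k] by simp
  next
    case (Suc m)
    then obtain j where j: "k = Suc (m + j)"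
      by (metis add_Suc le_Suc_ex)
    have R: "R (Suc j) = (real j + 1) * R j / (real j + 3/2)"
      by (simp add: R_def arcsin_deriv_fps_def pochhammer_Suc algebra_simps)
    have 1: "- real k + real m = - (real j + 1)" "- real k + 1/2 + real m = - (real j + 1/2)"
      "k - m = Suc j" "k - Suc m = j"
      by (simp_all add: j)
    have "pochhammer (- real k) (Suc m) / pochhammer (- real k + 1/2) (Suc m) =
        pochhammer (- real k) m / pochhammer (- real k + 1/2) m * ((real j + 1) / (real j + 1/2))"
      unfolding pochhammer_Suc 1 by (simp del: minus_add_distrib)
    also have "\<dots> = (2 * real k + 1) * R k / ((2 * real (Suc j) + 1) * R (Suc j)) * ((real j + 1) / (real j + 1/2))"
      using Suc 1 by simp
    also have "\<dots> = (2 * real k + 1) * R k / ((2 * real j + 1) * R j)"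
    proof -
      have "(2 * real (Suc j) + 1) * R (Suc j) * (real j + 1/2) = (2 * real j + 1) * R j * (real j + 1)"
        unfolding R by (simp add: divide_simps) (simp add: algebra_simps)
      then show ?thesis using R0[of "Suc j"] R0[of j]
        by (simp add: frac_eq_eq)
    qed
    finally show ?case by (simp only: 1)
  qed
  \<comment> \<open>The two symbols differ by a shift of one, so the quotient telescopes to its
    first factor over its last.\<close>
  have B: "pochhammer (- real k - 1/2) m / pochhammer (- real k + 1/2) m =
      (2 * real k + 1) / (2 * real (k - m) + 1)" if "m \<le> k" for m
  proof -
    have "(- real k - 1/2) * pochhammer (- real k + 1/2) m =
        pochhammer (- real k - 1/2) m * (- real k - 1/2 + real m)"
      using pochhammer_rec[of "- real k - 1/2" m] pochhammer_Suc[of "- real k - 1/2" m] by simp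
    then have "pochhammer (- real k - 1/2) m * (2 * real (k - m) + 1) =
        (2 * real k + 1) * pochhammer (- real k + 1/2) m"
      using that by (simp add: of_nat_diff algebra_simps)
    then show ?thesis
      using pochhammer_half_ne_0[of k m] by (simp add: frac_eq_eq)
  qed
  have C: "pochhammer 1 m * pochhammer 1 m / (pochhammer (3/2) m * pochhammer 2 m) = R m / (real m + 1)" for m
  proof -
    have "pochhammer 1 (Suc m) = pochhammer (2 :: real) m"
      by (subst pochhammer_rec) simp
    then have "pochhammer (2 :: real) m = (real m + 1) * fact m"
      by (simp add: algebra_simps flip: pochhammer_fact)
    then show ?thesis
      by (simp add: R_def arcsin_deriv_fps_def flip: pochhammer_fact)
  qed
  \<comment> \<open>One upper parameter 1 cancels \<open>fact m\<close>. By \<open>C\<close> the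
    factor in \<open>m\<close> is a coefficient of the squared arcsine series; by \<open>E\<close>
    the factors in \<open>k - m\<close> form one of the series itself. Summing over \<open>m\<close>
    is then a Cauchy product giving the cube.\<close>
  have f: "f m = (2 * real k + 1) ^ 2 * (R k * ((arcsin_fps ^ 2) $ m * arcsin_fps $ (k - m)))"
    if "m \<le> k" for m
  proof -
    have "f m = (pochhammer 1 m * pochhammer 1 m / (pochhammer (3/2) m * pochhammer 2 m)) *
        (pochhammer (- real k) m / pochhammer (- real k + 1/2) m) *
        (pochhammer (- real k - 1/2) m / pochhammer (- real k + 1/2) m)"
      by (simp add: f_def mult_ac flip: pochhammer_fact)
    also have "\<dots> = R m / (real m + 1) *
        ((2 * real k + 1) * R k / ((2 * real (k - m) + 1) * R (k - m))) *
        ((2 * real k + 1) / (2 * real (k - m) + 1))"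
      by (simp only: A[OF that] B[OF that] C)
    also have "\<dots> = (2 * real k + 1) ^ 2 * (R k * ((arcsin_fps ^ 2) $ m * arcsin_fps $ (k - m)))"
      unfolding arcsin_fps_power2_nth E R_def[symmetric]
      by (simp add: power2_eq_square[of "_ + _"] mult_ac)
    finally show ?thesis .
  qed
  have "f m = 0" if "m > k" for m
    using that by (simp add: f_def pochhammer_of_nat_eq_0_iff)
  then have "(\<Sum>m. f m) = (\<Sum>m\<le>k. f m)"
    by (intro suminf_finite) (auto simp: not_le)
  also have "\<dots> = (2 * real k + 1) ^ 2 * (R k * (\<Sum>m\<le>k. (arcsin_fps ^ 2) $ m * arcsin_fps $ (k - m)))"
    by (simp add: f sum_distrib_left)
  also have "(\<Sum>m\<le>k. (arcsin_fps ^ 2) $ m * arcsin_fps $ (k - m)) = (arcsin_fps ^ 3) $ k"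
    unfolding power_Suc2[of arcsin_fps 2, simplified] fps_mult_nth by (simp add: atLeast0AtMost)
  finally show ?thesis
    unfolding hypergeometric_F_altdef f_def[symmetric] by (simp add: R_def add_pos_nonneg)
qed

text \<open>Every further factor adds a convolution of at most \<open>k + 1\<close> terms, each at
  most the previous bound. Polynomial growth is all that the convergence arguments require.\<close>

lemma fps_power_nth_bounds:
  fixes F :: "real fps"
  assumes "\<And>k. 0 \<le> F $ k" "\<And>k. F $ k \<le> 1"
  shows "0 \<le> (F ^ Suc n) $ k \<and> (F ^ Suc n) $ k \<le> (real k + 1) ^ n"
proof (induction n arbitrary: k)
  case 0
  show ?case using assms by simp
next
  case (Suc n)
  have eq: "(F ^ Suc (Suc n)) $ k = (\<Sum>i=0..k. F $ i * (F ^ Suc n) $ (k - i))" for k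
    by (subst power_Suc) (simp only: fps_mult_nth)
  have IH: "0 \<le> (F ^ Suc n) $ k" "(F ^ Suc n) $ k \<le> (real k + 1) ^ n" for k
    using Suc by blast+
  have nonneg: "0 \<le> (F ^ Suc (Suc n)) $ k"
    unfolding eq by (intro sum_nonneg mult_nonneg_nonneg assms IH)
  have *: "F $ i * (F ^ Suc n) $ (k - i) \<le> 1 * (real k + 1) ^ n" for i
  proof (rule mult_mono)
    have "(F ^ Suc n) $ (k - i) \<le> (real (k - i) + 1) ^ n"
      using Suc by blast
    also have "\<dots> \<le> (real k + 1) ^ n"
      by (rule power_mono) auto
    finally show "(F ^ Suc n) $ (k - i) \<le> (real k + 1) ^ n" .
  qed (use assms IH in \<open>auto simp del: power_Suc\<close>)
  have "(F ^ Suc (Suc n)) $ k \<le> (\<Sum>i=0..k. 1 * (real k + 1) ^ n)"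
    unfolding eq by (intro sum_mono *)
  also have "\<dots> = (real k + 1) ^ Suc n"
    by (simp add: algebra_simps)
  finally show ?case using nonneg by blast
qed

lemma pochhammer_mono_real:
  fixes a b :: real
  assumes "0 \<le> a" "a \<le> b"
  shows "pochhammer a n \<le> pochhammer b n"
  unfolding pochhammer_prod using assms by (intro prod_mono) auto

lemma arcsin_fps_bounds: "0 \<le> arcsin_fps $ k" "arcsin_fps $ k \<le> 1"
proof -
  show "0 \<le> arcsin_fps $ k"
    by (simp add: arcsin_fps_def pochhammer_nonneg)
  have "pochhammer (1/2) k \<le> (fact k :: real)"
    unfolding pochhammer_fact by (rule pochhammer_mono_real) auto
  also have "\<dots> \<le> fact k * (2 * real k + 1)" by simp
  finally show "arcsin_fps $ k \<le> 1"
    by (simp add: arcsin_fps_def add_pos_nonneg)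
qed

lemma arcsin_deriv_fps_bounds: "0 \<le> arcsin_deriv_fps $ k" "arcsin_deriv_fps $ k \<le> 1"
proof -
  show "0 \<le> arcsin_deriv_fps $ k"
    by (simp add: arcsin_deriv_fps_def pochhammer_nonneg)
  have "fact k \<le> pochhammer (3/2 :: real) k"
    unfolding pochhammer_fact by (rule pochhammer_mono_real) auto
  then show "arcsin_deriv_fps $ k \<le> 1"
    by (simp add: arcsin_deriv_fps_def pochhammer_pos)
qed

lemma artanh_fps_bounds: "0 \<le> artanh_fps $ k" "artanh_fps $ k \<le> 1"
  by (simp_all add: artanh_fps_def)

lemma nat_plus_1_le_two_power: "real k + 1 \<le> 2 ^ k"
  by (induction k) auto

text \<open>The product majorant makes the family summable over all pairs, so it may be summed in
  any grouping. This justifies collecting equal powers of \<open>z\<close> across infinitely many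
  Bessel functions.\<close>

lemma double_series_antidiagonal:
  fixes u :: "nat \<Rightarrow> nat \<Rightarrow> real"
  assumes u: "\<And>k m. \<bar>u k m\<bar> \<le> a k * b m" and ab: "summable a" "summable b"
    and nonneg: "\<And>k. 0 \<le> a k" "\<And>m. 0 \<le> b m"
  shows "\<exists>S. (\<lambda>k. \<Sum>m. u k m) sums S \<and> (\<lambda>N. \<Sum>k\<le>N. u k (N - k)) sums S"
proof -
  have "a summable_on UNIV" "b summable_on UNIV"
    using ab nonneg by (simp_all add: summable_on_UNIV_nonneg_real_iff)
  then have "(\<lambda>(k, m). a k * b m) summable_on UNIV \<times> UNIV"
    using nonneg by (intro summable_on_SigmaI[where g = "\<lambda>k. a k * infsum b UNIV"])
      (auto intro!: has_sum_cmult_right has_sum_infsum summable_on_cmult_left)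
  then have ab': "(\<lambda>p. a (fst p) * b (snd p)) summable_on UNIV \<times> UNIV"
    by (simp add: case_prod_unfold)
  have "(\<lambda>p. u (fst p) (snd p)) summable_on UNIV \<times> UNIV"
    by (rule abs_summable_summable, rule summable_on_comparison_test[OF ab']) (use u in auto)
  then obtain S where S: "((\<lambda>p. u (fst p) (snd p)) has_sum S) (UNIV \<times> UNIV)"
    unfolding summable_on_def by blast
  have row: "((\<lambda>m. u k m) has_sum (\<Sum>m. u k m)) UNIV" for k
  proof -
    have "summable (\<lambda>m. norm (u k m))"
      by (rule summable_comparison_test'[where g = "\<lambda>m. a k * b m" and N = 0])
         (use u ab in \<open>auto intro: summable_mult\<close>)
    then show ?thesis
      using norm_summable_imp_has_sum summable_sums summable_norm_cancel by blast
  qed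
  have 1: "(\<lambda>k. \<Sum>m. u k m) sums S"
    by (rule has_sum_imp_sums, rule has_sum_SigmaD[OF S]) (use row in auto)
  have bij: "bij_betw (\<lambda>(N, k). (k, N - k)) (Sigma UNIV (\<lambda>N. {..N})) (UNIV \<times> (UNIV :: nat set))"
    by (rule bij_betwI[where g = "\<lambda>(k, m). (k + m, k)"]) auto
  have "((\<lambda>p. u (snd p) (fst p - snd p)) has_sum S) (Sigma UNIV (\<lambda>N. {..N}))"
    using S has_sum_reindex_bij_betw[OF bij, of "\<lambda>p. u (fst p) (snd p)" S]
    by (simp add: case_prod_unfold)
  then have "((\<lambda>N. \<Sum>k\<le>N. u k (N - k)) has_sum S) UNIV"
    by (rule has_sum_SigmaD) (auto intro!: has_sum_finiteI)
  with 1 show ?thesis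
    by (auto dest: has_sum_imp_sums)
qed

text \<open>This is \<open>(z/2)^(k-b) J_(k+b)(z)\<close> with the real powers combined into
  \<open>2 (k + m)\<close>. Natural exponents make it meaningful and continuous at
  \<open>z = 0\<close>, where the terms of the theorem are limits.\<close>

definition bessel_series :: "real \<Rightarrow> nat \<Rightarrow> real \<Rightarrow> real" where
  "bessel_series b k z =
     (\<Sum>m. (-1) ^ m * (z / 2) ^ (2 * (k + m)) / (fact m * Gamma (real (k + m) + b + 1)))"

lemma Gamma_add_nat_ge:
  assumes "b \<ge> (0 :: real)"
  shows "Gamma (b + 1) \<le> Gamma (real n + b + 1)"
proof -
  have "pochhammer (b + 1) n = Gamma (b + 1 + real n) / Gamma (b + 1)"
    using assms by (intro pochhammer_Gamma pos_notin_nonpos_Ints) auto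
  moreover have "pochhammer 1 n \<le> pochhammer (b + 1) n"
    using assms by (intro pochhammer_mono_real) auto
  moreover have "1 \<le> pochhammer (1 :: real) n"
    by (simp flip: pochhammer_fact)
  moreover have "Gamma (b + 1) > 0"
    using assms by (intro Gamma_real_pos) auto
  ultimately have "1 * Gamma (b + 1) \<le> Gamma (b + 1 + real n)"
    by (subst pos_le_divide_eq[symmetric]) linarith+
  then show ?thesis by (simp add: add_ac)
qed

text \<open>Replacing Gamma by its smallest possible value \<open>Gamma (b + 1)\<close> leaves a
  factor in \<open>k\<close> times a factor in \<open>m\<close>, as the regrouping of the double
  series demands.\<close>

lemma bessel_series_term_bound:
  assumes "b \<ge> 0"
  shows "\<bar>(-1) ^ m * (z / 2) ^ (2 * (k + m)) / (fact m * Gamma (real (k + m) + b + 1))\<bar>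
    \<le> ((z / 2)\<^sup>2) ^ k / Gamma (b + 1) * (((z / 2)\<^sup>2) ^ m / fact m)"
proof -
  have G: "Gamma (b + 1) > 0"
    using assms by (intro Gamma_real_pos) auto
  have "\<bar>(-1) ^ m * (z / 2) ^ (2 * (k + m)) / (fact m * Gamma (real (k + m) + b + 1))\<bar>
      = ((z / 2)\<^sup>2) ^ (k + m) / (fact m * Gamma (real (k + m) + b + 1))"
    using Gamma_add_nat_ge[OF assms, of "k + m"] G
    unfolding power_mult[of "z / 2" 2] abs_mult abs_divide by simp
  also have "\<dots> \<le> ((z / 2)\<^sup>2) ^ (k + m) / (fact m * Gamma (b + 1))"
    using Gamma_add_nat_ge[OF assms, of "k + m"] G
    by (intro divide_left_mono mult_left_mono mult_pos_pos) auto
  finally show ?thesis by (simp only: power_add times_divide_eq_left times_divide_eq_right divide_divide_eq_left mult_ac)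
qed

lemma summable_bessel_series:
  assumes "b \<ge> 0"
  shows "summable (\<lambda>m. (-1) ^ m * (z / 2) ^ (2 * (k + m)) / (fact m * Gamma (real (k + m) + b + 1)))"
proof (rule summable_comparison_test'[where N = 0])
  show "summable (\<lambda>m. ((z / 2)\<^sup>2) ^ k / Gamma (b + 1) * (((z / 2)\<^sup>2) ^ m / fact m))"
    by (intro summable_mult summable_power_over_fact)
qed (simp only: real_norm_def bessel_series_term_bound[OF assms])

text \<open>The exponents add up to \<open>(k - b) + (2m + k + b) = 2 (k + m)\<close>.\<close>

lemma bessel_J_eq_bessel_series:
  assumes "z > 0" "b \<ge> 0"
  shows "(z / 2) powr (real k - b) * bessel_J (real k + b) z = bessel_series b k z"
proof -
  define f where "f m = (-1) ^ m / (fact m * Gamma (real m + (real k + b) + 1)) *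
      (z / 2) powr (2 * real m + (real k + b))" for m
  define C where "C = (z / 2) powr (real k - b)"
  have C: "C \<noteq> 0" using assms by (simp add: C_def)
  have *: "C * f m = (-1) ^ m * (z / 2) ^ (2 * (k + m)) / (fact m * Gamma (real (k + m) + b + 1))" for m
  proof -
    have "C * (z / 2) powr (2 * real m + (real k + b)) = (z / 2) powr (real (2 * (k + m)))"
      unfolding C_def powr_add[symmetric] by (simp add: algebra_simps)
    also have "\<dots> = (z / 2) ^ (2 * (k + m))"
      using assms by (intro powr_realpow) auto
    finally have *: "C * (z / 2) powr (2 * real m + (real k + b)) = (z / 2) ^ (2 * (k + m))" .
    have G: "real m + (real k + b) + 1 = real (k + m) + b + 1"
      by simp
    show ?thesis
      unfolding f_def G *[symmetric] by (simp only: times_divide_eq_right times_divide_eq_left mult_ac)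
  qed
  have "summable (\<lambda>m. C * f m)"
    unfolding * by (rule summable_bessel_series) fact
  then have "summable f"
    using C by (simp add: summable_cmult_iff)
  then have "C * (\<Sum>m. f m) = (\<Sum>m. C * f m)"
    by (simp add: suminf_mult)
  also have "\<dots> = bessel_series b k z"
    by (simp only: bessel_series_def *)
  finally show ?thesis
    by (simp only: bessel_J_def f_def C_def)
qed

text \<open>Up to the factor \<open>y^k\<close> this is an everywhere convergent power series in
  \<open>y = (z/2)^2\<close>. The point of interest is \<open>z = 0\<close>.\<close>

lemma isCont_bessel_series:
  assumes "b \<ge> 0"
  shows "isCont (bessel_series b k) z"
proof -
  define c where "c m = (-1) ^ m / (fact m * Gamma (real (k + m) + b + 1))" for m
  have G: "Gamma (b + 1) > 0"
    using assms by (intro Gamma_real_pos) auto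
  have c: "\<bar>c m\<bar> \<le> 1 / Gamma (b + 1) / fact m" for m
  proof -
    have "\<bar>c m\<bar> = 1 / (fact m * Gamma (real (k + m) + b + 1))"
      using Gamma_add_nat_ge[OF assms, of "k + m"] G by (simp add: c_def)
    also have "\<dots> \<le> 1 / (fact m * Gamma (b + 1))"
      using Gamma_add_nat_ge[OF assms, of "k + m"] G
      by (intro divide_left_mono mult_left_mono mult_pos_pos) auto
    finally show ?thesis by (simp add: mult.commute)
  qed
  have s: "summable (\<lambda>m. c m * y ^ m)" for y
  proof (rule summable_comparison_test'[where N = 0])
    show "summable (\<lambda>m. 1 / Gamma (b + 1) * (\<bar>y\<bar> ^ m / fact m))"
      by (intro summable_mult summable_power_over_fact)
    fix m
    have "norm (c m * y ^ m) \<le> (1 / Gamma (b + 1) / fact m) * \<bar>y\<bar> ^ m"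
      unfolding norm_mult norm_power unfolding real_norm_def by (intro mult_right_mono c) simp
    then show "norm (c m * y ^ m) \<le> 1 / Gamma (b + 1) * (\<bar>y\<bar> ^ m / fact m)"
      by simp
  qed
  have "bessel_series b k = (\<lambda>z. ((z / 2)\<^sup>2) ^ k * (\<Sum>m. c m * ((z / 2)\<^sup>2) ^ m))"
  proof
    fix z
    have "bessel_series b k z = (\<Sum>m. ((z / 2)\<^sup>2) ^ k * (c m * ((z / 2)\<^sup>2) ^ m))"
      unfolding bessel_series_def c_def power_mult[of "z / 2" 2] power_add
      by (simp add: mult_ac)
    also have "\<dots> = ((z / 2)\<^sup>2) ^ k * (\<Sum>m. c m * ((z / 2)\<^sup>2) ^ m)"
      by (rule suminf_mult) (rule s)
    finally show "bessel_series b k z = ((z / 2)\<^sup>2) ^ k * (\<Sum>m. c m * ((z / 2)\<^sup>2) ^ m)" .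
  qed
  moreover have "isCont (\<lambda>y. \<Sum>m. c m * y ^ m) y" for y
    by (rule isCont_powser_converges_everywhere) (rule s)
  then have "isCont (\<lambda>z. \<Sum>m. c m * ((z / 2)\<^sup>2) ^ m) z"
    by (rule isCont_o2[rotated]) (auto intro!: continuous_intros)
  then have "isCont (\<lambda>z. ((z / 2)\<^sup>2) ^ k * (\<Sum>m. c m * ((z / 2)\<^sup>2) ^ m)) z"
    by (intro isCont_mult) (auto intro!: continuous_intros)
  ultimately show ?thesis by (simp only:)
qed

text \<open>The Gamma value and the power of \<open>z\<close> depend on \<open>k + m\<close> only,
  so they factor out of the terms with \<open>k + m = N\<close>. What remains is the alternating sum
  to be matched with \<open>artanh_fps_power_nth\<close>.\<close>

lemma bessel_series_antidiagonal:
  assumes b: "b \<ge> 0" and C: "\<And>k. \<bar>C k\<bar> \<le> K * q ^ k / fact k" and "K \<ge> 0" "q \<ge> 0"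
    and s: "(\<lambda>N. (z / 2) ^ (2 * N) / Gamma (real N + b + 1) *
      (\<Sum>k\<le>N. (-1) ^ (N - k) * C k / fact (N - k))) sums S"
  shows "(\<lambda>k. C k * bessel_series b k z) sums S"
proof -
  define u where "u k m = C k * ((-1) ^ m * (z / 2) ^ (2 * (k + m)) /
    (fact m * Gamma (real (k + m) + b + 1)))" for k m
  have G: "Gamma (b + 1) > 0"
    using b by (intro Gamma_real_pos) auto
  have "\<exists>S. (\<lambda>k. \<Sum>m. u k m) sums S \<and> (\<lambda>N. \<Sum>k\<le>N. u k (N - k)) sums S"
  proof (rule double_series_antidiagonal)
    show "\<bar>u k m\<bar> \<le> (K / Gamma (b + 1) * ((q * (z / 2)\<^sup>2) ^ k / fact k)) * (((z / 2)\<^sup>2) ^ m / fact m)" for k m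
    proof -
      have "\<bar>u k m\<bar> \<le> (K * q ^ k / fact k) * (((z / 2)\<^sup>2) ^ k / Gamma (b + 1) * (((z / 2)\<^sup>2) ^ m / fact m))"
        unfolding u_def abs_mult[of "C k"] using assms
        by (intro mult_mono bessel_series_term_bound C) auto
      also have "\<dots> = (K / Gamma (b + 1) * ((q * (z / 2)\<^sup>2) ^ k / fact k)) * (((z / 2)\<^sup>2) ^ m / fact m)"
        unfolding power_mult_distrib[of q] by (simp add: mult_ac)
      finally show ?thesis .
    qed
    show "summable (\<lambda>k. K / Gamma (b + 1) * ((q * (z / 2)\<^sup>2) ^ k / fact k))"
      "summable (\<lambda>m. ((z / 2)\<^sup>2) ^ m / fact m)"
      by (intro summable_mult summable_power_over_fact)+
    show "0 \<le> K / Gamma (b + 1) * ((q * (z / 2)\<^sup>2) ^ k / fact k)" for k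
      using assms G by simp
  qed auto
  then obtain S' where S': "(\<lambda>k. \<Sum>m. u k m) sums S'" "(\<lambda>N. \<Sum>k\<le>N. u k (N - k)) sums S'"
    by blast
  have 1: "(\<lambda>k. \<Sum>m. u k m) = (\<lambda>k. C k * bessel_series b k z)"
    unfolding u_def bessel_series_def
    by (intro ext suminf_mult summable_bessel_series b)
  have 2: "(\<lambda>N. \<Sum>k\<le>N. u k (N - k)) = (\<lambda>N. (z / 2) ^ (2 * N) / Gamma (real N + b + 1) *
      (\<Sum>k\<le>N. (-1) ^ (N - k) * C k / fact (N - k)))"
    unfolding u_def sum_distrib_left by (intro ext sum.cong refl) (simp add: mult_ac)
  have "S = S'"
    using s S'(2) unfolding 2 by (rule sums_unique2)
  with S'(1) show ?thesis
    unfolding 1 by simp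
qed

section \<open>The terms of the two claimed series\<close>

lemma cont_at_0_eq:
  assumes "\<And>z. z > 0 \<Longrightarrow> f z = g z" and "isCont g 0" "z \<ge> 0"
  shows "cont_at_0 f z = g z"
proof (cases "z = 0")
  case True
  have "(g \<longlongrightarrow> g 0) (at_right 0)"
    using assms(2) by (simp add: isCont_def filterlim_at_split)
  then have "(f \<longlongrightarrow> g 0) (at_right 0)"
    by (rule Lim_transform_eventually) (auto simp: eventually_at_filter assms(1))
  then have "Lim (at_right 0) f = g 0"
    by (intro tendsto_Lim) auto
  with True show ?thesis by (simp add: cont_at_0_def)
qed (use assms in \<open>simp add: cont_at_0_def\<close>)

lemma H2_term_eq:
  assumes "z > 0"
  shows "H2_term k z = arcsin_deriv_fps $ k * (arcsin_fps ^ 3) $ k / fact k * bessel_series 1 k z"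
proof -
  have "H2_term k z = (z powr (real k - 1) / 2 powr (real k - 1)) * bessel_J (real k + 1) z / fact k *
      (hypergeometric_F [1, 1, 1, - real k, - real k - 1/2]
         [- real k + 1/2, - real k + 1/2, 3/2, 2] 1 / (2 * real k + 1) ^ 2)"
    unfolding H2_term_def by simp
  also have "z powr (real k - 1) / 2 powr (real k - 1) * bessel_J (real k + 1) z = bessel_series 1 k z"
    using bessel_J_eq_bessel_series[OF assms, of 1 k] assms by (simp add: powr_divide)
  finally show ?thesis
    unfolding hypergeometric_F_eq_arcsin_fps by (simp add: mult_ac)
qed

text \<open>Writing \<open>2^(k+3/2)\<close> as \<open>8\<close> times \<open>2^(k-3/2)\<close> and
  \<open>flight_gamma\<close> as \<open>2 / pi\<close> times a coefficient, the constants combine to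
  \<open>3 sqrt pi / 4\<close>, which is \<open>Gamma (5/2)\<close>.\<close>

lemma H3_term_eq:
  assumes "z > 0"
  shows "3 * pi powr (3/2) * H3_term k z =
    3 * sqrt pi / 4 * (arcsin_fps ^ 4) $ k / fact (k + 1) * bessel_series (3/2) k z"
proof -
  have "2 powr (real k + 3/2) = (2 powr (real k - 3/2) * 2 powr 3 :: real)"
    unfolding powr_add[symmetric] by (rule arg_cong2[of _ _ _ _ "(powr)"]) simp_all
  also have "\<dots> = 2 powr (real k - 3/2) * 8"
    by simp
  finally have "H3_term k z = flight_gamma k * ((z powr (real k - 3/2) / 2 powr (real k - 3/2)) *
      bessel_J (real k + 3/2) z) / (8 * fact (k + 1))"
    unfolding H3_term_def by (simp add: mult_ac)
  also have "\<dots> = flight_gamma k * bessel_series (3/2) k z / (8 * fact (k + 1))"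
    using bessel_J_eq_bessel_series[OF assms, of "3/2" k] assms by (simp add: powr_divide)
  finally have 1: "H3_term k z = 2 / pi * (arcsin_fps ^ 4) $ k * bessel_series (3/2) k z / (8 * fact (k + 1))"
    by (simp add: flight_gamma_eq)
  have "pi powr (3/2) = pi * sqrt pi"
    using powr_add[of pi 1 "1/2"] by (simp add: powr_half_sqrt)
  then show ?thesis unfolding 1 by (simp add: mult_ac del: fact_Suc)
qed

text \<open>The even factors give \<open>2^N N!\<close>, the odd ones
  \<open>2^N (3/2)_N\<close>.\<close>

lemma fact_double_pochhammer: "fact (2 * N + 1) = (4 ^ N * fact N * pochhammer (3/2) N :: real)"
proof (induction N)
  case (Suc N)
  have "fact (2 * Suc N + 1) = (2 * real N + 3) * (2 * real N + 2) * (fact (2 * N + 1) :: real)"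
    by (simp add: algebra_simps)
  also have "\<dots> = 4 ^ Suc N * fact (Suc N) * pochhammer (3/2) (Suc N)"
    unfolding Suc pochhammer_Suc by (simp add: algebra_simps)
  finally show ?case .
qed simp

text \<open>In \<open>(2N+2)! = 2 4^N (N+1)! (3/2)_N\<close> the factorial \<open>(N+1)!\<close> is
  the Gamma value of the Bessel series with \<open>b = 1\<close>. The rest splits as
  \<open>(3/2)_N = (3/2)_k (k+3/2)_(N-k)\<close>: the second factor cancels the symbol in
  \<open>artanh_fps_power_nth\<close> for \<open>p = 3\<close>, the first one remains in
  \<open>C k\<close>, whose \<open>fact k\<close> cancels.\<close>

lemma sums_H2_term:
  assumes "z \<ge> 0" and "(\<lambda>N. 2 * ((-1) ^ N * z ^ (2 * N) * (artanh_fps ^ 3) $ N / fact (2 * N + 2))) sums S"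
  shows "(\<lambda>k. cont_at_0 (H2_term k) z) sums S"
proof -
  define C where "C k = arcsin_deriv_fps $ k * (arcsin_fps ^ 3) $ k / fact k" for k
  have eq: "cont_at_0 (H2_term k) z = C k * bessel_series 1 k z" for k
    unfolding C_def using assms(1) by (intro cont_at_0_eq H2_term_eq) (auto intro!: continuous_intros isCont_bessel_series)
  have "(z / 2) ^ (2 * N) / Gamma (real N + 1 + 1) * (\<Sum>k\<le>N. (-1) ^ (N - k) * C k / fact (N - k))
      = 2 * ((-1) ^ N * z ^ (2 * N) * (artanh_fps ^ 3) $ N / fact (2 * N + 2))" for N
  proof -
    have "fact (2 * N + 2) = (2 * (real N + 1)) * (fact (2 * N + 1) :: real)"
      by (simp add: algebra_simps)
    then have f: "fact (2 * N + 2) = (2 * 4 ^ N * fact (N + 1) * pochhammer (3/2) N :: real)"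
      unfolding fact_double_pochhammer by (simp add: algebra_simps)
    have g: "Gamma (real N + 1 + 1) = fact (N + 1)"
      using Gamma_fact[of "N + 1", where 'a = real] by (simp add: add_ac)
    have p: "(pochhammer (3/2) N :: real) = pochhammer (3/2) k * pochhammer (real k + 3/2) (N - k)" if "k \<le> N" for k
      using that pochhammer_product[of k N "3/2 :: real"] by (simp add: add.commute)
    have S: "(-1) ^ N * (artanh_fps ^ 3) $ N / pochhammer (3/2) N = (\<Sum>k\<le>N. (-1) ^ (N - k) * C k / fact (N - k))"
      unfolding artanh_fps_power_nth sum_distrib_left sum_divide_distrib
    proof (intro sum.cong refl)
      fix k assume k: "k \<in> {..N}"
      have "(-1) ^ N * (-1) ^ k = ((-1) ^ (N - k) :: real)"
        using k by (auto simp: minus_one_power_iff)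
      moreover have "pochhammer (3/2) k > (0 :: real)" "pochhammer (real k + 3/2) (N - k) > 0"
        by (auto intro!: pochhammer_pos)
      ultimately show "(-1) ^ N * ((-1) ^ k * (arcsin_fps ^ 3) $ k * pochhammer (real k + real 3 / 2) (N - k) / fact (N - k))
          / pochhammer (3/2) N = (-1) ^ (N - k) * C k / fact (N - k)"
        using k p[of k] by (simp add: C_def arcsin_deriv_fps_def field_simps)
    qed
    show ?thesis
      unfolding f g S[symmetric] power_mult by (simp add: power_divide mult_ac)
  qed
  then have *: "(\<lambda>N. (z / 2) ^ (2 * N) / Gamma (real N + 1 + 1) * (\<Sum>k\<le>N. (-1) ^ (N - k) * C k / fact (N - k))) sums S"
    using assms(2) by simp
  \<comment> \<open>The polynomial bound \<open>(k+1)^2\<close> is traded for the geometric one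
    \<open>(2^k)^2\<close>, the form that \<open>bessel_series_antidiagonal\<close> takes.\<close>
  have "\<bar>C k\<bar> \<le> 1 * 4 ^ k / fact k" for k
  proof -
    have "arcsin_deriv_fps $ k * (arcsin_fps ^ Suc 2) $ k \<le> 1 * (real k + 1) ^ 2"
      using arcsin_deriv_fps_bounds[of k] fps_power_nth_bounds[OF arcsin_fps_bounds, of 2 k]
      by (intro mult_mono) auto
    also have "\<dots> \<le> 1 * (2 ^ k) ^ 2"
      by (intro mult_left_mono power_mono) (use nat_plus_1_le_two_power[of k] in auto)
    also have "\<dots> = (2 ^ 2) ^ k"
      by (simp only: mult_1 power_mult[symmetric] mult.commute)
    also have "\<dots> = 4 ^ k" by simp
    finally have "arcsin_deriv_fps $ k * (arcsin_fps ^ 3) $ k \<le> 4 ^ k"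
      by (simp del: power_Suc)
    moreover have "0 \<le> arcsin_deriv_fps $ k * (arcsin_fps ^ Suc 2) $ k"
      using arcsin_deriv_fps_bounds[of k] fps_power_nth_bounds[OF arcsin_fps_bounds, of 2 k]
      by (intro mult_nonneg_nonneg) auto
    ultimately show ?thesis
      by (simp add: C_def divide_right_mono del: power_Suc)
  qed
  from bessel_series_antidiagonal[OF _ this _ _ *] show ?thesis
    by (simp add: eq)
qed

text \<open>Compared with two changes the roles are exchanged: for \<open>p = 4\<close> the symbol
  \<open>(k+2)_(N-k)\<close> cancels against \<open>(N+1)! = (k+1)! (k+2)_(N-k)\<close>, and the
  half-integer symbol \<open>(5/2)_N\<close> becomes the Gamma value of the Bessel series with
  \<open>b = 3/2\<close>.\<close>

lemma sums_H3_term: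
  assumes "z \<ge> 0" and "(\<lambda>N. 6 * ((-1) ^ N * z ^ (2 * N) * (artanh_fps ^ 4) $ N / fact (2 * N + 3))) sums S"
  shows "(\<lambda>k. 3 * pi powr (3/2) * cont_at_0 (H3_term k) z) sums S"
proof -
  define C where "C k = 3 * sqrt pi / 4 * (arcsin_fps ^ 4) $ k / fact (k + 1)" for k
  have pp: "3 * pi powr (3/2) \<noteq> 0" by simp
  have eq: "3 * pi powr (3/2) * cont_at_0 (H3_term k) z = C k * bessel_series (3/2) k z" for k
  proof -
    have "cont_at_0 (H3_term k) z = C k * bessel_series (3/2) k z / (3 * pi powr (3/2))"
    proof (rule cont_at_0_eq)
      fix z :: real assume "z > 0"
      from H3_term_eq[OF this, of k] pp
      show "H3_term k z = C k * bessel_series (3/2) k z / (3 * pi powr (3/2))"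
        unfolding C_def by (metis nonzero_mult_div_cancel_left)
    qed (use assms(1) pp in \<open>auto intro!: continuous_intros isCont_bessel_series\<close>)
    with pp show ?thesis by simp
  qed
  have "(z / 2) ^ (2 * N) / Gamma (real N + 3/2 + 1) * (\<Sum>k\<le>N. (-1) ^ (N - k) * C k / fact (N - k))
      = 6 * ((-1) ^ N * z ^ (2 * N) * (artanh_fps ^ 4) $ N / fact (2 * N + 3))" for N
  proof -
    have G: "Gamma (real N + 3/2 + 1) = 3 * sqrt pi / 4 * pochhammer (5/2) N"
    proof -
      have "pochhammer (5/2) N = Gamma (5/2 + real N) / Gamma (5/2 :: real)"
        by (intro pochhammer_Gamma pos_notin_nonpos_Ints) simp
      moreover have "Gamma (5/2 :: real) = 3 * sqrt pi / 4"
        using Gamma_plus1[of "3/2 :: real"] pos_notin_nonpos_Ints[of "3/2"]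
        by (simp add: Gamma_three_halves)
      ultimately show ?thesis by (simp add: add_ac)
    qed
    have "pochhammer (3/2) (Suc N) = 3/2 * pochhammer (5/2 :: real) N"
      by (subst pochhammer_rec) simp
    then have f: "fact (2 * N + 3) = (6 * 4 ^ N * fact (N + 1) * pochhammer (5/2) N :: real)"
      using fact_double_pochhammer[of "Suc N"] by (simp add: numeral_3_eq_3 del: fact_Suc)
    have p: "(fact (N + 1) :: real) = fact (k + 1) * pochhammer (real k + 2) (N - k)" if "k \<le> N" for k
      using that pochhammer_product[of "k + 1" "N + 1" "1 :: real"] by (simp add: add_ac flip: pochhammer_fact)
    have S: "(-1) ^ N * (artanh_fps ^ 4) $ N / fact (N + 1) =
        (\<Sum>k\<le>N. (-1) ^ (N - k) * ((arcsin_fps ^ 4) $ k / fact (k + 1)) / fact (N - k))"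
      unfolding artanh_fps_power_nth sum_distrib_left sum_divide_distrib
    proof (intro sum.cong refl)
      fix k assume k: "k \<in> {..N}"
      have "(-1) ^ N * (-1) ^ k = ((-1) ^ (N - k) :: real)"
        using k by (auto simp: minus_one_power_iff)
      moreover have "pochhammer (real k + 2) (N - k) > 0"
        by (auto intro!: pochhammer_pos)
      ultimately show "(-1) ^ N * ((-1) ^ k * (arcsin_fps ^ 4) $ k * pochhammer (real k + real 4 / 2) (N - k) / fact (N - k))
          / fact (N + 1) = (-1) ^ (N - k) * ((arcsin_fps ^ 4) $ k / fact (k + 1)) / fact (N - k)"
        using k p[of k] by (simp add: field_simps del: fact_Suc of_nat_Suc)
    qed
    have S': "(\<Sum>k\<le>N. (-1) ^ (N - k) * C k / fact (N - k)) = 3 * sqrt pi / 4 *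
        (\<Sum>k\<le>N. (-1) ^ (N - k) * ((arcsin_fps ^ 4) $ k / fact (k + 1)) / fact (N - k))"
      unfolding C_def sum_distrib_left by (intro sum.cong refl) (simp add: mult_ac)
    show ?thesis
      unfolding f G S' S[symmetric] power_mult by (simp add: power_divide mult_ac del: fact_Suc)
  qed
  then have *: "(\<lambda>N. (z / 2) ^ (2 * N) / Gamma (real N + 3/2 + 1) * (\<Sum>k\<le>N. (-1) ^ (N - k) * C k / fact (N - k))) sums S"
    using assms(2) by simp
  have "\<bar>C k\<bar> \<le> (3 * sqrt pi / 4) * 8 ^ k / fact k" for k
  proof -
    have "(arcsin_fps ^ Suc 3) $ k \<le> (real k + 1) ^ 3"
      using fps_power_nth_bounds[OF arcsin_fps_bounds, of 3 k] by simp
    also have "\<dots> \<le> (2 ^ k) ^ 3"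
      by (intro power_mono) (use nat_plus_1_le_two_power[of k] in auto)
    also have "\<dots> = (2 ^ 3) ^ k"
      by (simp only: power_mult[symmetric] mult.commute)
    also have "\<dots> = 8 ^ k" by simp
    finally have "(arcsin_fps ^ 4) $ k \<le> 8 ^ k"
      by (simp del: power_Suc)
    moreover have "0 \<le> (arcsin_fps ^ Suc 3) $ k"
      using fps_power_nth_bounds[OF arcsin_fps_bounds, of 3 k] by simp
    then have nonneg: "0 \<le> (arcsin_fps ^ 4) $ k"
      by (simp del: power_Suc)
    moreover have "3 * sqrt pi / 4 * (arcsin_fps ^ 4) $ k / fact (k + 1) \<le> 3 * sqrt pi / 4 * 8 ^ k / fact k"
    proof (rule frac_le)
      show "fact k \<le> (fact (k + 1) :: real)" by (rule fact_mono) simp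
    qed (use \<open>(arcsin_fps ^ 4) $ k \<le> 8 ^ k\<close> in auto)
    ultimately show ?thesis
      by (simp add: C_def del: fact_Suc)
  qed
  from bessel_series_antidiagonal[OF _ this _ _ *] show ?thesis
    by (simp add: eq)
qed

section \<open>Convolution powers of the sine cardinal\<close>

text \<open>A Beta integral. Integration by parts moves one power from the second factor to the
  first, so the induction on \<open>q\<close> needs \<open>p\<close> arbitrary.\<close>

lemma has_bochner_integral_power_convolution:
  fixes s :: real
  assumes "s \<ge> 0"
  shows "has_bochner_integral lborel
    (\<lambda>x. (x ^ p / fact p * ((s - x) ^ q / fact q)) * indicator {0..s} x) (s ^ (p + q + 1) / fact (p + q + 1))"
proof (induction q arbitrary: p)
  case 0
  have "has_bochner_integral lborel (\<lambda>x. (x ^ p / fact p * ((s - x) ^ 0 / fact 0)) * indicator {0..s} x)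
      (s ^ (p + 1) / fact (p + 1) - 0 ^ (p + 1) / fact (p + 1))"
    by (rule has_bochner_integral_FTC_Icc_real)
       (use assms in \<open>auto intro!: derivative_eq_intros continuous_intros simp: field_simps simp del: power_Suc of_nat_Suc\<close>)
  then show ?case by simp
next
  case (Suc q)
  \<comment> \<open>Both exponents are positive, so the boundary terms at \<open>0\<close> and
    \<open>s\<close> vanish.\<close>
  define f where "f x = x ^ (p + 1) / fact (p + 1) * ((s - x) ^ Suc q / fact (Suc q))" for x
  have *: "(f has_real_derivative x ^ p / fact p * ((s - x) ^ Suc q / fact (Suc q)) -
      x ^ (p + 1) / fact (p + 1) * ((s - x) ^ q / fact q)) (at x)" for x
  proof -
    have d: "((\<lambda>x. x ^ Suc k / fact (Suc k)) has_real_derivative x ^ k / fact k) (at x)" for k and x :: real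
      using DERIV_cdivide[OF DERIV_pow[of "Suc k" x], of "fact (Suc k)"] by simp
    have "((\<lambda>x. (s - x) ^ Suc q / fact (Suc q)) has_real_derivative (s - x) ^ q / fact q * (0 - 1)) (at x)"
      by (rule DERIV_chain2[OF d]) (intro derivative_intros)
    from DERIV_mult[OF d[of p x] this] show ?thesis
      unfolding f_def by (simp add: mult_ac del: fact_Suc power_Suc)
  qed
  have "has_bochner_integral lborel (\<lambda>x. (x ^ p / fact p * ((s - x) ^ Suc q / fact (Suc q)) -
      x ^ (p + 1) / fact (p + 1) * ((s - x) ^ q / fact q)) * indicator {0..s} x) (f s - f 0)"
    by (rule has_bochner_integral_FTC_Icc_real) (use assms * in \<open>auto intro!: continuous_intros\<close>)
  from has_bochner_integral_add[OF this Suc[of "p + 1"]]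
  show ?case
    by (simp add: f_def algebra_simps del: fact_Suc power_Suc)
qed

text \<open>The \<open>(n+1)\<close>-fold convolution power of \<open>sin (r s) / (r s)\<close>:
  \<open>n\<close> changes of direction give \<open>n + 1\<close> legs, hence the exponent
  \<open>Suc n\<close>.\<close>

definition flight_series :: "real \<Rightarrow> nat \<Rightarrow> real \<Rightarrow> real" where
  "flight_series r n s =
     (\<Sum>m. (-1) ^ m * r ^ (2 * m) * (artanh_fps ^ Suc n) $ m * (s ^ (2 * m + n) / fact (2 * m + n)))"

lemma artanh_fps_power_nonneg: "0 \<le> (artanh_fps ^ Suc n) $ m"
  using fps_power_nth_bounds[OF artanh_fps_bounds] by blast

lemma fact_mult_power_le: "fact k * (real k + 1) ^ n \<le> fact (k + n)"
proof (induction n)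
  case (Suc n)
  have "fact k * (real k + 1) ^ Suc n = (real k + 1) * (fact k * (real k + 1) ^ n)"
    by (simp add: mult_ac)
  also have "\<dots> \<le> (real k + real n + 1) * fact (k + n)"
    by (intro mult_mono Suc) auto
  finally show ?case by (simp add: algebra_simps)
qed simp

text \<open>The coefficient growth is absorbed by
  \<open>(m+1)^n m! \<le> (m+n)! \<le> (2m+n)!\<close>, which leaves an exponential series in
  \<open>(r s)^2\<close>.\<close>

lemma summable_flight_series_abs:
  assumes "s \<ge> 0"
  shows "summable (\<lambda>m. r ^ (2 * m) * (artanh_fps ^ Suc n) $ m * (s ^ (2 * m + n) / fact (2 * m + n)))"
proof (rule summable_comparison_test'[where N = 0])
  show "summable (\<lambda>m. s ^ n * (((r * s)\<^sup>2) ^ m / fact m))"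
    by (intro summable_mult summable_power_over_fact)
  fix m
  have "(artanh_fps ^ Suc n) $ m * fact m \<le> (real m + 1) ^ n * fact m"
    using fps_power_nth_bounds[OF artanh_fps_bounds] by (intro mult_right_mono) auto
  also have "\<dots> \<le> fact (m + n)"
    using fact_mult_power_le[of m n] by (simp add: mult.commute)
  also have "\<dots> \<le> fact (2 * m + n)"
    by (rule fact_mono) simp
  finally have *: "(artanh_fps ^ Suc n) $ m / fact (2 * m + n) \<le> 1 / fact m"
    by (simp add: divide_simps)
  have "r ^ (2 * m) * (artanh_fps ^ Suc n) $ m * (s ^ (2 * m + n) / fact (2 * m + n))
      = r ^ (2 * m) * s ^ (2 * m + n) * ((artanh_fps ^ Suc n) $ m / fact (2 * m + n))"
    by simp
  also have "\<dots> \<le> r ^ (2 * m) * s ^ (2 * m + n) * (1 / fact m)"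
    by (rule mult_left_mono[OF *]) (use assms in simp)
  also have "\<dots> = s ^ n * (((r * s)\<^sup>2) ^ m / fact m)"
  proof -
    have "((r * s)\<^sup>2) ^ m = r ^ (2 * m) * s ^ (2 * m)"
      by (simp only: power_mult[symmetric] power_mult_distrib)
    then show ?thesis by (simp add: power_add)
  qed
  finally show "norm (r ^ (2 * m) * (artanh_fps ^ Suc n) $ m * (s ^ (2 * m + n) / fact (2 * m + n)))
      \<le> s ^ n * (((r * s)\<^sup>2) ^ m / fact m)"
    using assms artanh_fps_power_nonneg[of n m] by (simp del: power_Suc)
qed

lemma summable_flight_series:
  assumes "s \<ge> 0"
  shows "summable (\<lambda>m. norm ((-1) ^ m * r ^ (2 * m) * (artanh_fps ^ Suc n) $ m * (s ^ (2 * m + n) / fact (2 * m + n))))"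
  using summable_flight_series_abs[OF assms, of r n] artanh_fps_power_nonneg assms
  by (simp add: abs_mult power_abs[symmetric] del: power_Suc)

text \<open>Convolving normalised monomials depends only on the total degree, so the coefficients
  combine by the Cauchy product of \<open>artanh_fps\<close> with its power; the extra 1 in the
  exponent turns \<open>n\<close> into \<open>Suc n\<close>.\<close>

lemma flight_series_convolution:
  assumes s: "s \<ge> 0"
  shows "(\<integral>x. (flight_series r 0 x * flight_series r n (s - x)) * indicator {0..s} x \<partial>lborel) =
    flight_series r (Suc n) s"
proof -
  define g where "g n m x = r ^ (2 * m) * (artanh_fps ^ Suc n) $ m * (x ^ (2 * m + n) / fact (2 * m + n))"
    for n m and x :: real
  have g_nonneg: "0 \<le> g n m x" if "x \<ge> 0" for n m x
    using that artanh_fps_power_nonneg by (simp add: g_def del: power_Suc)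
  have fs: "flight_series r n x = (\<Sum>m. (-1) ^ m * g n m x)" for n x
    by (simp add: flight_series_def g_def mult.assoc)
  have g_summable: "summable (\<lambda>m. norm ((-1) ^ m * g n m x))" "summable (\<lambda>m. g n m x)" if "x \<ge> 0" for n x
    using summable_flight_series[OF that, of r n] summable_flight_series_abs[OF that, of r n]
    by (simp_all add: g_def mult.assoc)
  \<comment> \<open>The part with \<open>r^(2m)\<close>, without its sign \<open>(-1)^m\<close>. It
    is nonnegative, so its integral is also that of its norm, and summability of these integrals
    permits integrating term by term.\<close>
  define f where "f m x = (\<Sum>i\<le>m. g 0 i x * g n (m - i) (s - x)) * indicator {0..s} x" for m x
  have f_nonneg: "0 \<le> f m x" for m x
    unfolding f_def by (auto simp: indicator_def intro!: sum_nonneg mult_nonneg_nonneg g_nonneg)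
  have f_int: "has_bochner_integral lborel (f m) (g (Suc n) m s)" for m
  proof -
    have "has_bochner_integral lborel (\<lambda>x. \<Sum>i\<le>m. r ^ (2 * m) * (artanh_fps $ i * (artanh_fps ^ Suc n) $ (m - i)) *
        ((x ^ (2 * i) / fact (2 * i) * ((s - x) ^ (2 * (m - i) + n) / fact (2 * (m - i) + n))) * indicator {0..s} x))
        (\<Sum>i\<le>m. r ^ (2 * m) * (artanh_fps $ i * (artanh_fps ^ Suc n) $ (m - i)) *
          (s ^ (2 * i + (2 * (m - i) + n) + 1) / fact (2 * i + (2 * (m - i) + n) + 1)))"
      by (intro has_bochner_integral_sum has_bochner_integral_mult_right
          has_bochner_integral_power_convolution s)
    also have "(\<Sum>i\<le>m. r ^ (2 * m) * (artanh_fps $ i * (artanh_fps ^ Suc n) $ (m - i)) *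
          (s ^ (2 * i + (2 * (m - i) + n) + 1) / fact (2 * i + (2 * (m - i) + n) + 1))) =
        (\<Sum>i\<le>m. r ^ (2 * m) * (artanh_fps $ i * (artanh_fps ^ Suc n) $ (m - i)) *
          (s ^ (2 * m + Suc n) / fact (2 * m + Suc n)))"
    proof (intro sum.cong refl)
      fix i assume "i \<in> {..m}"
      then have "2 * i + (2 * (m - i) + n) + 1 = 2 * m + Suc n" by simp
      then show "r ^ (2 * m) * (artanh_fps $ i * (artanh_fps ^ Suc n) $ (m - i)) *
          (s ^ (2 * i + (2 * (m - i) + n) + 1) / fact (2 * i + (2 * (m - i) + n) + 1)) =
        r ^ (2 * m) * (artanh_fps $ i * (artanh_fps ^ Suc n) $ (m - i)) *
          (s ^ (2 * m + Suc n) / fact (2 * m + Suc n))"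
        by (simp only:)
    qed
    also have "\<dots> = g (Suc n) m s"
      unfolding g_def power_Suc[of artanh_fps "Suc n"] fps_mult_nth
      by (simp add: sum_distrib_left sum_distrib_right sum_divide_distrib atLeast0AtMost del: power_Suc fact_Suc)
    also have "(\<lambda>x. \<Sum>i\<le>m. r ^ (2 * m) * (artanh_fps $ i * (artanh_fps ^ Suc n) $ (m - i)) *
        ((x ^ (2 * i) / fact (2 * i) * ((s - x) ^ (2 * (m - i) + n) / fact (2 * (m - i) + n))) * indicator {0..s} x)) = f m"
      unfolding f_def g_def sum_distrib_right
    proof (intro ext sum.cong refl)
      fix x :: real and i assume "i \<in> {..m}"
      then have "2 * m = 2 * i + 2 * (m - i)" by simp
      then have "r ^ (2 * m) = r ^ (2 * i) * r ^ (2 * (m - i))"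
        by (metis power_add)
      then show "r ^ (2 * m) * (artanh_fps $ i * (artanh_fps ^ Suc n) $ (m - i)) *
          ((x ^ (2 * i) / fact (2 * i) * ((s - x) ^ (2 * (m - i) + n) / fact (2 * (m - i) + n))) * indicator {0..s} x) =
        r ^ (2 * i) * (artanh_fps ^ Suc 0) $ i * (x ^ (2 * i + 0) / fact (2 * i + 0)) *
          (r ^ (2 * (m - i)) * (artanh_fps ^ Suc n) $ (m - i) * ((s - x) ^ (2 * (m - i) + n) / fact (2 * (m - i) + n))) *
          indicator {0..s} x"
        by (simp add: mult_ac del: power_Suc)
    qed
    finally show ?thesis .
  qed
  have f_sums: "(\<lambda>m. (-1) ^ m * f m x) sums ((flight_series r 0 x * flight_series r n (s - x)) * indicator {0..s} x)"
    and f_summable: "summable (\<lambda>m. f m x)" for x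
  proof -
    consider "x \<in> {0..s}" | "x \<notin> {0..s}" by blast
    then have "(\<lambda>m. (-1) ^ m * f m x) sums ((flight_series r 0 x * flight_series r n (s - x)) * indicator {0..s} x) \<and>
        summable (\<lambda>m. f m x)"
    proof cases
      case 1
      then have x: "x \<ge> 0" "s - x \<ge> 0" by auto
      have "(\<lambda>m. \<Sum>i\<le>m. ((-1) ^ i * g 0 i x) * ((-1) ^ (m - i) * g n (m - i) (s - x))) sums
          (flight_series r 0 x * flight_series r n (s - x))"
        unfolding fs by (intro Cauchy_product_sums g_summable x)
      also have "(\<lambda>m. \<Sum>i\<le>m. ((-1) ^ i * g 0 i x) * ((-1) ^ (m - i) * g n (m - i) (s - x))) =
          (\<lambda>m. (-1) ^ m * f m x)"
      proof
        fix m
        have E: "((-1) ^ i * g 0 i x) * ((-1) ^ (m - i) * g n (m - i) (s - x)) =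
            (-1) ^ m * (g 0 i x * g n (m - i) (s - x))" if "i \<le> m" for i
        proof -
          have "(-1) ^ m = ((-1) ^ i * (-1) ^ (m - i) :: real)"
            using that by (simp flip: power_add)
          then show ?thesis by (simp add: mult_ac)
        qed
        have "(\<Sum>i\<le>m. ((-1) ^ i * g 0 i x) * ((-1) ^ (m - i) * g n (m - i) (s - x))) =
            (\<Sum>i\<le>m. (-1) ^ m * (g 0 i x * g n (m - i) (s - x)))"
          by (intro sum.cong refl E) simp
        then show "(\<Sum>i\<le>m. ((-1) ^ i * g 0 i x) * ((-1) ^ (m - i) * g n (m - i) (s - x))) = (-1) ^ m * f m x"
          using 1 by (simp add: f_def sum_distrib_left[symmetric])
      qed
      finally have "(\<lambda>m. (-1) ^ m * f m x) sums (flight_series r 0 x * flight_series r n (s - x))" .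
      moreover have "summable (\<lambda>m. \<Sum>i\<le>m. g 0 i x * g n (m - i) (s - x))"
        using g_summable x g_nonneg
        by (intro summable_Cauchy_product) auto
      ultimately show ?thesis
        using 1 by (simp add: f_def)
    qed (simp add: f_def)
    then show "(\<lambda>m. (-1) ^ m * f m x) sums ((flight_series r 0 x * flight_series r n (s - x)) * indicator {0..s} x)"
      "summable (\<lambda>m. f m x)" by auto
  qed
  have "(\<integral>x. (flight_series r 0 x * flight_series r n (s - x)) * indicator {0..s} x \<partial>lborel) =
      (\<integral>x. (\<Sum>m. (-1) ^ m * f m x) \<partial>lborel)"
    using f_sums by (simp add: sums_iff)
  also have "\<dots> = (\<Sum>m. \<integral>x. (-1) ^ m * f m x \<partial>lborel)"
  proof (rule integral_suminf)
    show "integrable lborel (\<lambda>x. (-1) ^ m * f m x)" for m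
      using f_int by (auto simp: has_bochner_integral_iff)
    show "AE x in lborel. summable (\<lambda>m. norm ((-1) ^ m * f m x))"
      using f_summable f_nonneg by (simp add: abs_mult)
    show "summable (\<lambda>m. \<integral>x. norm ((-1) ^ m * f m x) \<partial>lborel)"
      using f_int f_nonneg g_summable(2)[OF s, of "Suc n"]
      by (simp add: abs_mult has_bochner_integral_iff)
  qed
  also have "\<dots> = flight_series r (Suc n) s"
    unfolding fs using f_int by (simp add: has_bochner_integral_iff)
  finally show ?thesis .
qed

text \<open>At frequency zero the convolution power is the volume of a simplex; later this yields
  the Poisson probability.\<close>

lemma flight_series_zero_speed: "flight_series 0 n s = s ^ n / fact n"
proof -
  have "flight_series 0 n s = (\<Sum>m\<in>{0}. (-1) ^ m * 0 ^ (2 * m) * (artanh_fps ^ Suc n) $ m * (s ^ (2 * m + n) / fact (2 * m + n)))"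
    unfolding flight_series_def by (rule suminf_finite) auto
  moreover have "(artanh_fps ^ Suc n) $ 0 = 1"
    by (simp add: fps_power_zeroth artanh_fps_def del: power_Suc)
  ultimately show ?thesis by (simp del: power_Suc)
qed

section \<open>The random flight\<close>

text \<open>Independence makes the joint law of \<open>X\<close> and the identity map into
  \<open>F\<close> a product measure; then Fubini applies. With the identity map as second
  component, infinitely many variables of different types need not be packed into one.\<close>

lemma (in prob_space) integral_indep_sub_algebra:
  fixes h :: "'b \<times> 'a \<Rightarrow> complex"
  assumes X: "random_variable N X" and F: "(\<lambda>\<omega>. \<omega>) \<in> M \<rightarrow>\<^sub>M F"
    and indep: "indep_set {X -` A \<inter> space M |A. A \<in> sets N} (sets F)"
    and sp: "space F = space M"
    and h: "h \<in> borel_measurable (N \<Otimes>\<^sub>M F)"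
    and bound: "\<And>x \<omega>. norm (h (x, \<omega>)) \<le> B"
  shows "(\<integral>\<omega>. h (X \<omega>, \<omega>) \<partial>M) = (\<integral>\<omega>. (\<integral>\<omega>'. h (X \<omega>, \<omega>') \<partial>M) \<partial>M)"
proof -
  interpret X: prob_space "distr M N X" by (rule prob_space_distr) fact
  interpret F: prob_space "distr M F (\<lambda>\<omega>. \<omega>)" by (rule prob_space_distr) fact
  have "distr M N X \<Otimes>\<^sub>M distr M F (\<lambda>\<omega>. \<omega>) = distr M (N \<Otimes>\<^sub>M F) (\<lambda>\<omega>. (X \<omega>, \<omega>))"
  proof (rule pair_measure_eqI)
    fix A B assume "A \<in> sets (distr M N X)" "B \<in> sets (distr M F (\<lambda>\<omega>. \<omega>))"
    then have A: "A \<in> sets N" and B: "B \<in> sets F" by auto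
    have B': "B \<in> sets M" "B \<subseteq> space M" "(\<lambda>\<omega>. \<omega>) -` B \<inter> space M = B"
      using measurable_sets[OF F B] sets.sets_into_space[OF B] sp by (auto simp: Int_absorb2)
    have "prob (X -` A \<inter> space M \<inter> B) = prob (X -` A \<inter> space M) * prob B"
      by (rule indep_setD[OF indep]) (use A B in auto)
    moreover have "(\<lambda>\<omega>. (X \<omega>, \<omega>)) -` (A \<times> B) \<inter> space M = X -` A \<inter> space M \<inter> B"
      by auto
    ultimately show "emeasure (distr M N X) A * emeasure (distr M F (\<lambda>\<omega>. \<omega>)) B =
        emeasure (distr M (N \<Otimes>\<^sub>M F) (\<lambda>\<omega>. (X \<omega>, \<omega>))) (A \<times> B)"
      using A B B' X F
      by (simp add: emeasure_distr measurable_Pair pair_measureI emeasure_eq_measure ennreal_mult)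
  qed (auto intro: X.sigma_finite_measure F.sigma_finite_measure cong: sets_pair_measure_cong)
  then have eq: "distr M N X \<Otimes>\<^sub>M distr M F (\<lambda>\<omega>. \<omega>) = distr M (N \<Otimes>\<^sub>M F) (\<lambda>\<omega>. (X \<omega>, \<omega>))" .
  interpret P: pair_prob_space "distr M N X" "distr M F (\<lambda>\<omega>. \<omega>)" ..
  have h': "h \<in> borel_measurable (distr M N X \<Otimes>\<^sub>M distr M F (\<lambda>\<omega>. \<omega>))"
    using h by (simp cong: measurable_cong_sets sets_pair_measure_cong)
  have int: "integrable (distr M N X \<Otimes>\<^sub>M distr M F (\<lambda>\<omega>. \<omega>)) h"
    using bound by (intro P.P.integrable_const_bound[where B = B] h') (auto simp: split_paired_all)
  have m: "(\<lambda>\<omega>. (X \<omega>, \<omega>)) \<in> M \<rightarrow>\<^sub>M N \<Otimes>\<^sub>M F"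
    by (rule measurable_Pair) fact+
  have hx: "(\<lambda>\<omega>'. h (x, \<omega>')) \<in> borel_measurable F" if "x \<in> space N" for x
    using measurable_compose[OF measurable_Pair1'[OF that] h] .
  have "(\<integral>\<omega>. h (X \<omega>, \<omega>) \<partial>M) = (\<integral>p. h p \<partial>distr M (N \<Otimes>\<^sub>M F) (\<lambda>\<omega>. (X \<omega>, \<omega>)))"
    by (rule integral_distr[symmetric]) fact+
  also have "\<dots> = (\<integral>x. (\<integral>\<omega>'. h (x, \<omega>') \<partial>distr M F (\<lambda>\<omega>. \<omega>)) \<partial>distr M N X)"
    unfolding eq[symmetric] by (rule P.integral_fst'[symmetric]) fact
  also have "\<dots> = (\<integral>\<omega>. (\<integral>\<omega>'. h (X \<omega>, \<omega>') \<partial>distr M F (\<lambda>\<omega>. \<omega>)) \<partial>M)"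
  proof (rule integral_distr[OF X])
    show "(\<lambda>x. \<integral>\<omega>'. h (x, \<omega>') \<partial>distr M F (\<lambda>\<omega>. \<omega>)) \<in> borel_measurable N"
      using F.borel_measurable_lebesgue_integral[of "\<lambda>x \<omega>'. h (x, \<omega>')" N] h
      by (simp add: case_prod_unfold cong: measurable_cong_sets sets_pair_measure_cong)
  qed
  also have "\<dots> = (\<integral>\<omega>. (\<integral>\<omega>'. h (X \<omega>, \<omega>') \<partial>M) \<partial>M)"
    by (intro Bochner_Integration.integral_cong refl integral_distr F hx)
       (use X in \<open>auto dest: measurable_space\<close>)
  finally show ?thesis .
qed

text \<open>
  The integrand of the characteristic function at time \<open>s\<close>, restricted to exactly \<open>n\<close> switches,
  of a flight that starts with the \<open>j\<close>-th waiting time. The speed is absorbed into \<open>v\<close>.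
\<close>
primrec flight_weight ::
  "(nat \<Rightarrow> 'a \<Rightarrow> real) \<Rightarrow> (nat \<Rightarrow> 'a \<Rightarrow> real ^ 3) \<Rightarrow> real ^ 3 \<Rightarrow> nat \<Rightarrow> nat \<Rightarrow> real \<Rightarrow> 'a \<Rightarrow> complex"
where
  "flight_weight T D v 0 j s \<omega> = (if s < T j \<omega> then iexp ((s *\<^sub>R v) \<bullet> D j \<omega>) else 0)"
| "flight_weight T D v (Suc n) j s \<omega> =
     (if T j \<omega> \<le> s
      then iexp ((T j \<omega> *\<^sub>R v) \<bullet> D j \<omega>) * flight_weight T D v n (Suc j) (s - T j \<omega>) \<omega> else 0)"

lemma norm_flight_weight: "norm (flight_weight T D v n j s \<omega>) \<le> 1"
  by (induction n arbitrary: j s) (auto simp: norm_mult)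

text \<open>Measurability is joint in time and outcome because the recursion replaces the time by
  the random \<open>s - T j\<close>.\<close>

lemma measurable_flight_weight:
  assumes "\<And>k. k \<ge> j \<Longrightarrow> T k \<in> borel_measurable F" "\<And>k. k \<ge> j \<Longrightarrow> D k \<in> borel_measurable F"
  shows "(\<lambda>p. flight_weight T D v n j (fst p) (snd p)) \<in> borel_measurable (borel \<Otimes>\<^sub>M F)"
  using assms
proof (induction n arbitrary: j)
  case 0
  have [measurable]: "T j \<in> borel_measurable F" "D j \<in> borel_measurable F"
    using 0 by auto
  show ?case by simp
next
  case (Suc n)
  have [measurable]: "T j \<in> borel_measurable F" "D j \<in> borel_measurable F"
    using Suc.prems by auto
  have IH: "(\<lambda>p. flight_weight T D v n (Suc j) (fst p) (snd p)) \<in> borel_measurable (borel \<Otimes>\<^sub>M F)"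
    by (rule Suc.IH) (use Suc.prems in auto)
  have "(\<lambda>p. (fst p - T j (snd p), snd p)) \<in> borel \<Otimes>\<^sub>M F \<rightarrow>\<^sub>M borel \<Otimes>\<^sub>M F"
    by measurable
  from measurable_compose[OF this IH]
  have [measurable]: "(\<lambda>p. flight_weight T D v n (Suc j) (fst p - T j (snd p)) (snd p)) \<in> borel_measurable (borel \<Otimes>\<^sub>M F)"
    by simp
  show ?case by simp
qed

lemma flight_weight_eq:
  assumes "\<And>k. T k \<omega> \<ge> 0"
  shows "s \<ge> 0 \<Longrightarrow> flight_weight T D v n j s \<omega> =
    (if (\<Sum>k<n. T (j + k) \<omega>) \<le> s \<and> s < (\<Sum>k<Suc n. T (j + k) \<omega>)
     then iexp (v \<bullet> ((\<Sum>k<n. T (j + k) \<omega> *\<^sub>R D (j + k) \<omega>) + (s - (\<Sum>k<n. T (j + k) \<omega>)) *\<^sub>R D (j + n) \<omega>))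
     else 0)"
proof (induction n arbitrary: j s)
  case 0
  then show ?case by simp
next
  case (Suc n)
  have shift: "(\<Sum>k<Suc m. f (j + k)) = f j + (\<Sum>k<m. f (Suc j + k))" for f :: "nat \<Rightarrow> 'c :: comm_monoid_add" and m
    by (simp add: sum.lessThan_Suc_shift del: sum.lessThan_Suc)
  show ?case
  proof (cases "T j \<omega> \<le> s")
    case True
    then have "flight_weight T D v n (Suc j) (s - T j \<omega>) \<omega> =
      (if (\<Sum>k<n. T (Suc j + k) \<omega>) \<le> s - T j \<omega> \<and> s - T j \<omega> < (\<Sum>k<Suc n. T (Suc j + k) \<omega>)
       then iexp (v \<bullet> ((\<Sum>k<n. T (Suc j + k) \<omega> *\<^sub>R D (Suc j + k) \<omega>) +
         (s - T j \<omega> - (\<Sum>k<n. T (Suc j + k) \<omega>)) *\<^sub>R D (Suc j + n) \<omega>))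
       else 0)"
      by (intro Suc.IH) simp
    with True show ?thesis
      unfolding shift[of "\<lambda>k. T k \<omega>"] shift[of "\<lambda>k. T k \<omega> *\<^sub>R D k \<omega>"]
      by (simp add: inner_add_right algebra_simps flip: exp_add del: sum.lessThan_Suc)
  next
    \<comment> \<open>If the first event comes after \<open>s\<close>, nonnegativity keeps all
      longer partial sums above \<open>s\<close> as well, and both sides are 0.\<close>
    case False
    have "T j \<omega> + (\<Sum>k<n. T (Suc j + k) \<omega>) \<ge> T j \<omega>"
      using assms by (simp add: sum_nonneg)
    with False show ?thesis
      unfolding shift[of "\<lambda>k. T k \<omega>"] by simp
  qed
qed

text \<open>Nonnegative waiting times make the event times nondecreasing, so the counted set is an
  initial segment.\<close>

lemma event_count_eq_iff:
  assumes T: "\<And>k. T k \<omega> \<ge> 0" and n: "n \<ge> 1"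
  shows "event_count T t \<omega> = n \<longleftrightarrow> event_time T n \<omega> \<le> t \<and> t < event_time T (Suc n) \<omega>"
proof -
  define A where "A = {n. n \<ge> 1 \<and> event_time T n \<omega> \<le> t}"
  have mono: "event_time T i \<omega> \<le> event_time T j \<omega>" if "i \<le> j" for i j
    unfolding event_time_def using that T by (intro sum_mono2) auto
  have down: "i \<in> A" if "k \<in> A" "1 \<le> i" "i \<le> k" for i k
    using that mono[of i k] by (auto simp: A_def)
  show ?thesis
  proof
    assume "event_count T t \<omega> = n"
    then have card: "card A = n"
      by (simp add: event_count_def A_def)
    \<comment> \<open>An infinite set has \<open>card\<close> 0, so \<open>n \<ge> 1\<close> gives
      finiteness.\<close>
    then have fin: "finite A" "A \<noteq> {}"
      using n by (auto intro: card_ge_0_finite)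
    have "A = {1..Max A}"
      using fin down[OF Max_in[OF fin]] by (auto simp: A_def)
    then have "A = {1..n}"
      using card by (metis card_atLeastAtMost diff_Suc_1)
    then show "event_time T n \<omega> \<le> t \<and> t < event_time T (Suc n) \<omega>"
      using n by (auto simp: A_def set_eq_iff not_le dest: spec[of _ n] spec[of _ "Suc n"])
  next
    assume *: "event_time T n \<omega> \<le> t \<and> t < event_time T (Suc n) \<omega>"
    have "A = {1..n}"
    proof (intro set_eqI iffI)
      fix i assume "i \<in> A"
      then show "i \<in> {1..n}"
        using * mono[of "Suc n" i] by (cases "i \<le> n") (auto simp: A_def)
    next
      fix i assume "i \<in> {1..n}"
      then show "i \<in> A"
        using * mono[of i n] by (auto simp: A_def)
    qed
    then show "event_count T t \<omega> = n"
      by (simp add: event_count_def A_def)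
  qed
qed

lemma borel_measurable_flight_series [measurable]: "flight_series r n \<in> borel_measurable borel"
  unfolding flight_series_def[abs_def] by measurable

context markov_random_flight
begin

section \<open>Sigma-algebras generated by groups of waiting times and directions\<close>

definition gen_sets :: "nat + nat \<Rightarrow> 'a set set" where
  "gen_sets = case_sum (\<lambda>k. {T k -` A \<inter> space M |A. A \<in> sets borel})
                       (\<lambda>k. {D k -` A \<inter> space M |A. A \<in> sets borel})"

definition gen_algebra :: "(nat + nat) set \<Rightarrow> 'a measure" where
  "gen_algebra K = sigma (space M) (\<Union>i\<in>K. gen_sets i)"

lemma T_measurable [measurable]: "T k \<in> borel_measurable M"
  using waiting_time_distributed[of k] by (simp add: distributed_def)

declare direction_measurable [measurable]

lemma gen_sets_subset: "gen_sets i \<subseteq> sets M"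
  by (auto simp: gen_sets_def split: sum.splits)

lemma gen_sets_Pow: "(\<Union>i\<in>K. gen_sets i) \<subseteq> Pow (space M)"
  using gen_sets_subset sets.space_closed by blast

lemma space_gen_algebra [simp]: "space (gen_algebra K) = space M"
  by (simp add: gen_algebra_def gen_sets_Pow space_measure_of)

lemma sets_gen_algebra: "sets (gen_algebra K) = sigma_sets (space M) (\<Union>i\<in>K. gen_sets i)"
  by (simp add: gen_algebra_def gen_sets_Pow)

lemma ident_gen_algebra: "(\<lambda>\<omega>. \<omega>) \<in> M \<rightarrow>\<^sub>M gen_algebra K"
  unfolding gen_algebra_def
  using gen_sets_subset by (intro measurable_measure_of gen_sets_Pow) (auto dest: sets.sets_into_space)

lemma T_measurable_gen_algebra:
  assumes "Inl k \<in> K"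
  shows "T k \<in> borel_measurable (gen_algebra K)"
proof (rule measurableI)
  fix A :: "real set" assume "A \<in> sets borel"
  then have "T k -` A \<inter> space M \<in> gen_sets (Inl k)"
    by (auto simp: gen_sets_def)
  then show "T k -` A \<inter> space (gen_algebra K) \<in> sets (gen_algebra K)"
    using assms by (auto simp: sets_gen_algebra)
qed simp

lemma D_measurable_gen_algebra:
  assumes "Inr k \<in> K"
  shows "D k \<in> borel_measurable (gen_algebra K)"
proof (rule measurableI)
  fix A :: "(real ^ 3) set" assume "A \<in> sets borel"
  then have "D k -` A \<inter> space M \<in> gen_sets (Inr k)"
    by (auto simp: gen_sets_def)
  then show "D k -` A \<inter> space (gen_algebra K) \<in> sets (gen_algebra K)"
    using assms by (auto simp: sets_gen_algebra)
qed simp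

lemma Int_stable_gen_sets: "Int_stable (gen_sets i)"
proof (cases i)
  case (Inl k)
  show ?thesis
    unfolding Inl gen_sets_def sum.case
  proof (rule Int_stableI, clarify)
    fix A B :: "real set" assume "A \<in> sets borel" "B \<in> sets borel"
    then show "\<exists>C. T k -` A \<inter> space M \<inter> (T k -` B \<inter> space M) = T k -` C \<inter> space M \<and> C \<in> sets borel"
      by (intro exI[of _ "A \<inter> B"]) auto
  qed
next
  case (Inr k)
  show ?thesis
    unfolding Inr gen_sets_def sum.case
  proof (rule Int_stableI, clarify)
    fix A B :: "(real ^ 3) set" assume "A \<in> sets borel" "B \<in> sets borel"
    then show "\<exists>C. D k -` A \<inter> space M \<inter> (D k -` B \<inter> space M) = D k -` C \<inter> space M \<and> C \<in> sets borel"
      by (intro exI[of _ "A \<inter> B"]) auto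
  qed
qed

text \<open>The disjoint index groups \<open>{i}\<close> and \<open>K\<close> generate independent
  sigma-algebras, since each generator is closed under intersections.\<close>

lemma indep_gen_algebra:
  assumes "i \<notin> K"
  shows "indep_set (gen_sets i) (sets (gen_algebra K))"
proof -
  define I where "I = case_bool {i} K"
  have "indep_sets (\<lambda>b. sigma_sets (space M) (\<Union>i\<in>I b. gen_sets i)) UNIV"
  proof (rule indep_sets_collect_sigma)
    show "indep_sets gen_sets (\<Union>b\<in>UNIV. I b)"
      unfolding gen_sets_def by (rule indep_sets_mono_index[OF _ indep]) simp
    show "disjoint_family_on I UNIV"
      using assms by (auto simp: disjoint_family_on_def I_def split: bool.splits)
  qed (rule Int_stable_gen_sets)
  then have "indep_set (sigma_sets (space M) (gen_sets i)) (sets (gen_algebra K))"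
    unfolding indep_set_def sets_gen_algebra
    by (rule indep_sets_cong[THEN iffD1, rotated 2]) (auto simp: I_def split: bool.split)
  then show ?thesis
    unfolding indep_set_def
    by (rule indep_sets_mono_sets) (auto split: bool.split)
qed

lemma integral_waiting_time:
  fixes h :: "real \<times> 'a \<Rightarrow> complex"
  assumes "Inl k \<notin> K" and "h \<in> borel_measurable (borel \<Otimes>\<^sub>M gen_algebra K)"
    and "\<And>x \<omega>. norm (h (x, \<omega>)) \<le> B"
  shows "(\<integral>\<omega>. h (T k \<omega>, \<omega>) \<partial>M) = (\<integral>\<omega>. (\<integral>\<omega>'. h (T k \<omega>, \<omega>') \<partial>M) \<partial>M)"
  using indep_gen_algebra[OF assms(1)] assms(2,3)
  by (intro integral_indep_sub_algebra[where N = borel and F = "gen_algebra K"] ident_gen_algebra)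
     (auto simp: gen_sets_def)

lemma integral_direction:
  fixes h :: "(real ^ 3) \<times> 'a \<Rightarrow> complex"
  assumes "Inr k \<notin> K" and "h \<in> borel_measurable (borel \<Otimes>\<^sub>M gen_algebra K)"
    and "\<And>x \<omega>. norm (h (x, \<omega>)) \<le> B"
  shows "(\<integral>\<omega>. h (D k \<omega>, \<omega>) \<partial>M) = (\<integral>\<omega>. (\<integral>\<omega>'. h (D k \<omega>, \<omega>') \<partial>M) \<partial>M)"
  using indep_gen_algebra[OF assms(1)] assms(2,3)
  by (intro integral_indep_sub_algebra[where N = borel and F = "gen_algebra K"] ident_gen_algebra)
     (auto simp: gen_sets_def)

text \<open>The coefficients \<open>1 / (2m+1)\<close> of \<open>artanh_fps\<close> turn
  \<open>(2m)!\<close> into the \<open>(2m+1)!\<close> of the sphere.\<close>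

lemma direction_char_fun: "(\<integral>\<omega>. iexp ((s *\<^sub>R v) \<bullet> D k \<omega>) \<partial>M) = of_real (flight_series (norm v) 0 s)"
proof -
  have "(\<integral>\<omega>. iexp ((s *\<^sub>R v) \<bullet> D k \<omega>) \<partial>M) = (\<integral>u. iexp ((s *\<^sub>R v) \<bullet> u) \<partial>distr M borel (D k))"
    by (rule integral_distr[symmetric]) auto
  also have "\<dots> = of_real (\<Sum>m. (-1) ^ m * norm (s *\<^sub>R v) ^ (2 * m) / fact (2 * m + 1))"
    unfolding direction_distr by (rule uniform_sphere_char_fun)
  also have "(\<Sum>m. (-1) ^ m * norm (s *\<^sub>R v) ^ (2 * m) / fact (2 * m + 1)) = flight_series (norm v) 0 s"
    unfolding flight_series_def
    by (intro suminf_cong) (simp add: artanh_fps_def power_mult_distrib power_even_abs ac_simps)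
  finally show ?thesis .
qed

definition later :: "nat \<Rightarrow> (nat + nat) set" where
  "later j = Inl ` {j..} \<union> Inr ` {j..}"

lemma measurable_flight_weight_later:
  assumes "later j \<subseteq> K"
  shows "(\<lambda>p. flight_weight T D v n j (fst p) (snd p)) \<in> borel_measurable (borel \<Otimes>\<^sub>M gen_algebra K)"
  using assms
  by (intro measurable_flight_weight T_measurable_gen_algebra D_measurable_gen_algebra) (auto simp: later_def)

text \<open>Renewal argument at the first event. The density \<open>l exp (- l x)\<close> and the
  factor \<open>exp (- l (s - x))\<close> of the remaining flight multiply to
  \<open>l exp (- l s)\<close>, free of \<open>x\<close>, so a pure convolution is left and each
  change contributes one factor \<open>l\<close>.\<close>

lemma integral_flight_weight:
  assumes "s \<ge> 0"
  shows "(\<integral>\<omega>. flight_weight T D v n j s \<omega> \<partial>M) =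
    of_real (exp (- l * s) * l ^ n * flight_series (norm v) n s)"
  using assms
proof (induction n arbitrary: j s)
  case 0
  define K where "K = {Inl j :: nat + nat}"
  have [measurable]: "T j \<in> borel_measurable (gen_algebra K)"
    by (rule T_measurable_gen_algebra) (simp add: K_def)
  have "(\<integral>\<omega>. flight_weight T D v 0 j s \<omega> \<partial>M) =
      (\<integral>\<omega>. (\<lambda>(d, \<omega>). if s < T j \<omega> then iexp ((s *\<^sub>R v) \<bullet> d) else 0) (D j \<omega>, \<omega>) \<partial>M)"
    by simp
  also have "\<dots> = (\<integral>\<omega>. (\<integral>\<omega>'. (\<lambda>(d, \<omega>). if s < T j \<omega> then iexp ((s *\<^sub>R v) \<bullet> d) else 0) (D j \<omega>, \<omega>') \<partial>M) \<partial>M)"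
  proof (rule integral_direction[where K = K and B = 1])
    show "(\<lambda>(d, \<omega>). if s < T j \<omega> then iexp ((s *\<^sub>R v) \<bullet> d) else 0) \<in> borel_measurable (borel \<Otimes>\<^sub>M gen_algebra K)"
      by measurable
  qed (auto simp: K_def)
  also have "\<dots> = (\<integral>\<omega>. iexp ((s *\<^sub>R v) \<bullet> D j \<omega>) * of_real (exp (- l * s)) \<partial>M)"
  proof (intro Bochner_Integration.integral_cong refl)
    fix \<omega>
    have "(\<integral>\<omega>'. (\<lambda>(d, \<omega>). if s < T j \<omega> then iexp ((s *\<^sub>R v) \<bullet> d) else 0) (D j \<omega>, \<omega>') \<partial>M) =
        (\<integral>\<omega>'. iexp ((s *\<^sub>R v) \<bullet> D j \<omega>) * of_real (indicator {\<omega> \<in> space M. s < T j \<omega>} \<omega>') \<partial>M)"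
      by (intro Bochner_Integration.integral_cong) (auto simp: indicator_def)
    also have "\<dots> = iexp ((s *\<^sub>R v) \<bullet> D j \<omega>) * of_real (prob {\<omega> \<in> space M. s < T j \<omega>})"
      by (simp add: integral_mult_right_zero)
    also have "prob {\<omega> \<in> space M. s < T j \<omega>} = exp (- s * l)"
      by (rule exponential_distributedD_gt[OF waiting_time_distributed]) (use 0 rate_pos in auto)
    finally show "(\<integral>\<omega>'. (\<lambda>(d, \<omega>). if s < T j \<omega> then iexp ((s *\<^sub>R v) \<bullet> d) else 0) (D j \<omega>, \<omega>') \<partial>M) =
        iexp ((s *\<^sub>R v) \<bullet> D j \<omega>) * of_real (exp (- l * s))"
      by (simp add: mult.commute)
  qed
  also have "\<dots> = of_real (flight_series (norm v) 0 s) * of_real (exp (- l * s))"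
    by (simp only: integral_mult_left_zero direction_char_fun)
  finally show ?case by simp
next
  case (Suc n)
  define K where "K = insert (Inr j) (later (Suc j))"
  have [measurable]: "D j \<in> borel_measurable (gen_algebra K)"
    by (rule D_measurable_gen_algebra) (simp add: K_def)
  \<comment> \<open>The flight after the first event, with the time of that event frozen at
    \<open>x\<close>.\<close>
  define W where "W x \<omega> = (if x \<le> s then flight_weight T D v n (Suc j) (s - x) \<omega> else 0)" for x \<omega>
  have W_meas: "(\<lambda>p. W (fst p) (snd p)) \<in> borel_measurable (borel \<Otimes>\<^sub>M gen_algebra K')"
    if "later (Suc j) \<subseteq> K'" for K'
  proof -
    have 1: "(\<lambda>p. (s - fst p, snd p)) \<in> borel \<Otimes>\<^sub>M gen_algebra K' \<rightarrow>\<^sub>M borel \<Otimes>\<^sub>M gen_algebra K'"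
      by measurable
    have [measurable]: "(\<lambda>p. flight_weight T D v n (Suc j) (s - fst p) (snd p)) \<in> borel_measurable (borel \<Otimes>\<^sub>M gen_algebra K')"
      using measurable_compose[OF 1 measurable_flight_weight_later[OF that]] by simp
    show ?thesis unfolding W_def by measurable
  qed
  have W_bound: "norm (W x \<omega>) \<le> 1" for x \<omega>
    by (simp add: W_def norm_flight_weight)
  define \<phi> where "\<phi> x = flight_series (norm v) 0 x" for x
  define g where "g x = (if x \<le> s then \<phi> x * (exp (- l * (s - x)) * l ^ n * flight_series (norm v) n (s - x)) else 0)" for x
  \<comment> \<open>For frozen \<open>x\<close> the first direction is independent of everything
    later, so the expectation factors.\<close>
  have inner: "(\<integral>\<omega>. iexp ((x *\<^sub>R v) \<bullet> D j \<omega>) * W x \<omega> \<partial>M) = of_real (g x)" for x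
  proof -
    have Wx: "W x \<in> borel_measurable (gen_algebra (later (Suc j)))"
      using measurable_compose[OF measurable_Pair1' W_meas[OF order_refl], of x] by simp
    have "(\<integral>\<omega>. iexp ((x *\<^sub>R v) \<bullet> D j \<omega>) * W x \<omega> \<partial>M) =
        (\<integral>\<omega>. (\<lambda>(d, \<omega>). iexp ((x *\<^sub>R v) \<bullet> d) * W x \<omega>) (D j \<omega>, \<omega>) \<partial>M)"
      by simp
    also have "\<dots> = (\<integral>\<omega>. (\<integral>\<omega>'. (\<lambda>(d, \<omega>). iexp ((x *\<^sub>R v) \<bullet> d) * W x \<omega>) (D j \<omega>, \<omega>') \<partial>M) \<partial>M)"
      by (rule integral_direction[where K = "later (Suc j)" and B = 1])
         (use Wx W_bound in \<open>auto simp: later_def norm_mult\<close>)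
    also have "\<dots> = (\<integral>\<omega>. iexp ((x *\<^sub>R v) \<bullet> D j \<omega>) \<partial>M) * (\<integral>\<omega>'. W x \<omega>' \<partial>M)"
      by (simp only: prod.case integral_mult_right_zero integral_mult_left_zero)
    also have "(\<integral>\<omega>. iexp ((x *\<^sub>R v) \<bullet> D j \<omega>) \<partial>M) = of_real (\<phi> x)"
      by (simp only: direction_char_fun \<phi>_def)
    also have "(\<integral>\<omega>'. W x \<omega>' \<partial>M) =
        of_real (if x \<le> s then exp (- l * (s - x)) * l ^ n * flight_series (norm v) n (s - x) else 0)"
      unfolding W_def using Suc.IH[of "s - x" "Suc j"] by auto
    finally show ?thesis by (auto simp: g_def)
  qed
  have "(\<integral>\<omega>. flight_weight T D v (Suc n) j s \<omega> \<partial>M) =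
      (\<integral>\<omega>. (\<lambda>p. iexp ((fst p *\<^sub>R v) \<bullet> D j (snd p)) * W (fst p) (snd p)) (T j \<omega>, \<omega>) \<partial>M)"
    by (intro Bochner_Integration.integral_cong) (auto simp: W_def)
  also have "\<dots> = (\<integral>\<omega>. (\<integral>\<omega>'. (\<lambda>p. iexp ((fst p *\<^sub>R v) \<bullet> D j (snd p)) * W (fst p) (snd p)) (T j \<omega>, \<omega>') \<partial>M) \<partial>M)"
  proof (rule integral_waiting_time[where K = K and B = 1])
    have [measurable]: "(\<lambda>p. W (fst p) (snd p)) \<in> borel_measurable (borel \<Otimes>\<^sub>M gen_algebra K)"
      by (rule W_meas) (auto simp: K_def)
    show "(\<lambda>p. iexp ((fst p *\<^sub>R v) \<bullet> D j (snd p)) * W (fst p) (snd p)) \<in> borel_measurable (borel \<Otimes>\<^sub>M gen_algebra K)"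
      by measurable
  qed (use W_bound in \<open>auto simp: K_def later_def norm_mult\<close>)
  also have "\<dots> = of_real (\<integral>\<omega>. g (T j \<omega>) \<partial>M)"
    by (simp only: fst_conv snd_conv inner integral_complex_of_real)
  also have "(\<integral>\<omega>. g (T j \<omega>) \<partial>M) = (\<integral>x. exponential_density l x * g x \<partial>lborel)"
  proof (rule distributed_integral[OF waiting_time_distributed, symmetric])
    show "g \<in> borel_measurable lborel"
      unfolding g_def[abs_def] \<phi>_def by measurable
  qed (use rate_pos in \<open>auto intro: exponential_density_nonneg\<close>)
  \<comment> \<open>The lower end of \<open>{0..s}\<close> comes from the density vanishing on
    negative arguments, the upper end from the cutoff in \<open>g\<close>.\<close>
  also have "\<dots> = (\<integral>x. exp (- l * s) * l ^ Suc n * ((flight_series (norm v) 0 x * flight_series (norm v) n (s - x)) * indicator {0..s} x) \<partial>lborel)"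
  proof (intro Bochner_Integration.integral_cong refl)
    fix x :: real
    have "exp (- x * l) * exp (- l * (s - x)) = exp (- l * s)"
      by (simp add: algebra_simps flip: exp_add)
    then show "exponential_density l x * g x =
        exp (- l * s) * l ^ Suc n * ((flight_series (norm v) 0 x * flight_series (norm v) n (s - x)) * indicator {0..s} x)"
      by (auto simp: exponential_density_def g_def \<phi>_def indicator_def)
  qed
  also have "\<dots> = exp (- l * s) * l ^ Suc n * flight_series (norm v) (Suc n) s"
    using flight_series_convolution[OF Suc.prems] by (simp only: integral_mult_right_zero)
  finally show ?case .
qed

section \<open>From the weights to the conditional characteristic function\<close>

lemma AE_waiting_times_nonneg: "AE \<omega> in M. \<forall>k. T k \<omega> \<ge> 0"
  unfolding AE_all_countable
proof
  fix k
  have "prob {\<omega> \<in> space M. 0 < T k \<omega>} = 1"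
    using exponential_distributedD_gt[OF waiting_time_distributed, of 0 k] rate_pos by simp
  then have "AE \<omega> in M. 0 < T k \<omega>"
    by (subst (asm) prob_Collect_eq_1) auto
  then show "AE \<omega> in M. 0 \<le> T k \<omega>" by eventually_elim simp
qed

lemma event_count_measurable [measurable]: "(\<lambda>\<omega>. event_count T t \<omega>) \<in> M \<rightarrow>\<^sub>M count_space UNIV"
  unfolding event_count_def event_time_def by measurable

text \<open>The restricted integral and the probability of the conditioning event share the factor
  \<open>exp (- l t) l^n\<close>; in the quotient the rate disappears.\<close>

lemma cond_char_fun_eq:
  assumes "t > 0" "n \<ge> 1"
  shows "cond_char_fun M c T D n \<alpha> t =
    of_real (fact n / t ^ n * flight_series (c * norm \<alpha>) n t)"
proof -
  define S where "S = {\<omega> \<in> space M. event_count T t \<omega> = n}"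
  define X where "X = flight_position c T D t"
  have S: "S \<in> sets M" unfolding S_def by measurable
  have weight: "AE \<omega> in M. (if \<omega> \<in> S then iexp (\<beta> \<bullet> X \<omega>) else 0) = flight_weight T D (c *\<^sub>R \<beta>) n 0 t \<omega>" for \<beta>
    using AE_waiting_times_nonneg AE_space
  proof eventually_elim
    case (elim \<omega>)
    then have T: "\<And>k. T k \<omega> \<ge> 0" by simp
    have "\<omega> \<in> S \<longleftrightarrow> (\<Sum>k<n. T k \<omega>) \<le> t \<and> t < (\<Sum>k<Suc n. T k \<omega>)"
      using event_count_eq_iff[where T = T and \<omega> = \<omega>, OF T assms(2), of t] elim by (simp add: S_def event_time_def)
    then show ?case
      using assms(1) unfolding flight_weight_eq[where T = T and \<omega> = \<omega>, OF T less_imp_le[OF assms(1)]]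
      by (auto simp: S_def X_def flight_position_def event_time_def Let_def)
  qed
  have meas: "flight_weight T D v n 0 t \<in> borel_measurable M" for v
    using measurable_compose[OF measurable_Pair1' measurable_flight_weight[of 0 T M D v n], of t] by simp
  define J where "J r = exp (- l * t) * l ^ n * flight_series r n t" for r
  have X_meas [measurable]: "X \<in> borel_measurable M"
  proof -
    \<comment> \<open>The position has the random index \<open>event_count\<close>; it takes
      countably many values, so measurability is checked for each fixed index.\<close>
    have "(\<lambda>\<omega>. (\<lambda>n \<omega>. c *\<^sub>R ((\<Sum>k<n. T k \<omega> *\<^sub>R D k \<omega>) + (t - event_time T n \<omega>) *\<^sub>R D n \<omega>))
        (event_count T t \<omega>) \<omega>) \<in> borel_measurable M"
      unfolding event_time_def by (rule measurable_compose_countable) measurable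
    then show ?thesis by (simp add: X_def flight_position_def[abs_def] Let_def)
  qed
  have int: "(\<integral>\<omega>. (if \<omega> \<in> S then iexp (\<beta> \<bullet> X \<omega>) else 0) \<partial>M) = of_real (J (norm (c *\<^sub>R \<beta>)))" for \<beta>
  proof -
    have "(\<integral>\<omega>. (if \<omega> \<in> S then iexp (\<beta> \<bullet> X \<omega>) else 0) \<partial>M) = (\<integral>\<omega>. flight_weight T D (c *\<^sub>R \<beta>) n 0 t \<omega> \<partial>M)"
      by (intro integral_cong_AE weight meas) (use S in measurable)
    also have "\<dots> = of_real (J (norm (c *\<^sub>R \<beta>)))"
      unfolding J_def by (rule integral_flight_weight) (use assms in simp)
    finally show ?thesis .
  qed
  \<comment> \<open>The formula \<open>int\<close> at frequency 0 already contains the Poisson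
    probability of exactly \<open>n\<close> events.\<close>
  have "of_real (prob S) = (\<integral>\<omega>. (of_real (indicator S \<omega>) :: complex) \<partial>M)"
    using S by (simp add: integral_complex_of_real)
  also have "\<dots> = (\<integral>\<omega>. (if \<omega> \<in> S then iexp (0 \<bullet> X \<omega>) else 0) \<partial>M)"
    by (intro Bochner_Integration.integral_cong) (auto simp: indicator_def)
  also have "\<dots> = of_real (J 0)"
    unfolding int by simp
  finally have prob_S: "prob S = exp (- l * t) * l ^ n * (t ^ n / fact n)"
    by (simp only: of_real_eq_iff J_def flight_series_zero_speed)
  then have prob_pos: "prob S > 0"
    using rate_pos assms by simp
  \<comment> \<open>A real-valued density, available because \<open>prob S\<close> is positive,
    turns the conditional expectation into a Bochner integral over \<open>M\<close>.\<close>
  have "uniform_measure M S = density M (\<lambda>\<omega>. ennreal (indicator S \<omega> / prob S))"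
    unfolding uniform_measure_def
    using prob_pos divide_ennreal[of 1 "prob S"] S
    by (intro density_cong) (auto simp: emeasure_eq_measure indicator_def)
  then have "cond_char_fun M c T D n \<alpha> t =
      (\<integral>\<omega>. (indicator S \<omega> / prob S) *\<^sub>R iexp (\<alpha> \<bullet> X \<omega>) \<partial>M)"
    unfolding cond_char_fun_def S_def[symmetric] X_def[symmetric]
    using S by (simp add: integral_density)
  also have "\<dots> = (\<integral>\<omega>. of_real (1 / prob S) * (if \<omega> \<in> S then iexp (\<alpha> \<bullet> X \<omega>) else 0) \<partial>M)"
    by (intro Bochner_Integration.integral_cong) (auto simp: indicator_def scaleR_conv_of_real)
  also have "\<dots> = of_real (1 / prob S) * of_real (J (c * norm \<alpha>))"
    using speed_pos by (simp only: integral_mult_right_zero int norm_scaleR abs_of_pos)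
  also have "\<dots> = of_real (fact n / t ^ n * flight_series (c * norm \<alpha>) n t)"
    unfolding of_real_mult[symmetric] of_real_eq_iff prob_S J_def
    using rate_pos assms by simp
  finally show ?thesis .
qed

end

lemma flight_series_sums:
  assumes "r \<ge> 0" "t > 0"
  shows "(\<lambda>N. fact n * ((-1) ^ N * (r * t) ^ (2 * N) * (artanh_fps ^ Suc n) $ N / fact (2 * N + n))) sums
    (fact n / t ^ n * flight_series r n t)"
proof -
  have "(\<lambda>N. (-1) ^ N * r ^ (2 * N) * (artanh_fps ^ Suc n) $ N * (t ^ (2 * N + n) / fact (2 * N + n))) sums
      flight_series r n t"
    unfolding flight_series_def
    by (rule summable_sums, rule summable_norm_cancel, rule summable_flight_series) (use assms in simp)
  from sums_mult[OF this, of "fact n / t ^ n"] assms(2) show ?thesis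
    by (simp add: power_add power_mult_distrib mult_ac del: power_Suc)
qed

theorem theorem1:
  fixes M :: "'a measure" and c l t :: real
    and T :: "nat \<Rightarrow> 'a \<Rightarrow> real" and D :: "nat \<Rightarrow> 'a \<Rightarrow> real ^ 3" and \<alpha> :: "real ^ 3"
  assumes "markov_random_flight M c l T D"
    and "t > 0"
  shows
    "(let z = c * t * norm \<alpha> in
        (summable (\<lambda>k. cont_at_0 (H2_term k) z) \<and>
         cond_char_fun M c T D 2 \<alpha> t =
           complex_of_real (\<Sum>k. cont_at_0 (H2_term k) z)) \<and>
        (summable (\<lambda>k. cont_at_0 (H3_term k) z) \<and>
         cond_char_fun M c T D 3 \<alpha> t =
           complex_of_real (3 * pi powr (3/2) * (\<Sum>k. cont_at_0 (H3_term k) z))))"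
proof -
  interpret markov_random_flight M c l T D by fact
  define r where "r = c * norm \<alpha>"
  define z where "z = c * t * norm \<alpha>"
  have r: "r \<ge> 0" and z: "z \<ge> 0" and rt: "r * t = z"
    using speed_pos assms(2) by (simp_all add: r_def z_def mult_ac)
  have "(\<lambda>N. fact 2 * ((-1) ^ N * z ^ (2 * N) * (artanh_fps ^ Suc 2) $ N / fact (2 * N + 2))) sums
      (fact 2 / t ^ 2 * flight_series r 2 t)"
    unfolding rt[symmetric] by (rule flight_series_sums) fact+
  then have "(\<lambda>N. 2 * ((-1) ^ N * z ^ (2 * N) * (artanh_fps ^ 3) $ N / fact (2 * N + 2))) sums
      (fact 2 / t ^ 2 * flight_series r 2 t)"
    by (simp only: fact_2 Suc_numeral semiring_norm)
  from sums_H2_term[OF z this]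
  have H2: "summable (\<lambda>k. cont_at_0 (H2_term k) z)"
    "cond_char_fun M c T D 2 \<alpha> t = complex_of_real (\<Sum>k. cont_at_0 (H2_term k) z)"
    using cond_char_fun_eq[OF assms(2), of 2 \<alpha>] by (simp_all add: sums_iff r_def)
  have "(\<lambda>N. fact 3 * ((-1) ^ N * z ^ (2 * N) * (artanh_fps ^ Suc 3) $ N / fact (2 * N + 3))) sums
      (fact 3 / t ^ 3 * flight_series r 3 t)"
    unfolding rt[symmetric] by (rule flight_series_sums) fact+
  moreover have "fact 3 = (6 :: real)"
    by (simp add: fact_numeral)
  ultimately have "(\<lambda>N. 6 * ((-1) ^ N * z ^ (2 * N) * (artanh_fps ^ 4) $ N / fact (2 * N + 3))) sums
      (fact 3 / t ^ 3 * flight_series r 3 t)"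
    by (simp only: Suc_numeral semiring_norm)
  from sums_H3_term[OF z this]
  have H3: "summable (\<lambda>k. 3 * pi powr (3/2) * cont_at_0 (H3_term k) z)"
    "cond_char_fun M c T D 3 \<alpha> t = complex_of_real (\<Sum>k. 3 * pi powr (3/2) * cont_at_0 (H3_term k) z)"
    using cond_char_fun_eq[OF assms(2), of 3 \<alpha>] by (simp_all add: sums_iff r_def)
  have "summable (\<lambda>k. cont_at_0 (H3_term k) z)"
    using H3(1) by (simp add: summable_cmult_iff)
  with H2 H3 show ?thesis
    unfolding z_def[symmetric] Let_def by (simp add: suminf_mult)
qed

end
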